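(* Let $G=C\rtimes\langle b\rangle$, where $|b|=2$ and $b^{-1}gb=g^{-1}$ for every $g\in C$. Let $\mathcal{A}$ be an $S$-ring over $G$ such that $C$ is an $\mathcal{A}$-subgroup. Then the pair $\mathcal{X}_{\mathcal{A}}=(\Omega,S_{\mathcal{A}})$, where $$S_{\mathcal{A}}=\{r_X,\, s_Y:\; X,Y\subseteq C,\; X,\, bY\in \mathcal{S}(\mathcal{A})\},$$ is an association scheme.
   Context: Setting. Let $r$ be a prime, $d\ge1$, $q=r^d$, $\mathbb{F}$ the field of order $q$, and $n\ge 1$ a divisor of $q-1$ such that $q(q-1)/n$ is even. Let $K$ be the subgroup of index $n$ in $\mathbb{F}^*$ and $C=\mathbb{F}^*/K$, a cyclic group of order $n$ with identity element $e$. Let $V$ be the space of column vectors $\mathbb{F}^2$ and $\Omega=\{Kv: v\in V\setminus\{0\}\}$, where $Kv=\{xv:x\in K\}$; so $|\Omega|=(q+1)n$. For $g=Ky\in C$ and $\alpha=Kv\in\Omega$ put $g\alpha=K(yv)\in\Omega$. Define $\langle\cdot,\cdot\rangle:\Omega\times\Omega\to C\cup\{0\}$ by $\langle Ku,Kv\rangle=K\det(u,v)$, where $\det(u,v)=u_1v_2-u_2v_1$ (read as $0$ if $\det(u,v)=0$); this is well defined and symmetric since $-1\in K$. For $g\in C$ put $$r_g=\{(\alpha,\beta)\in\Omega^2: \beta=g\alpha\},\qquad s_g=\{(\alpha,\beta)\in\Omega^2:\langle\alpha,\beta\rangle=g\}.$$ For $X\subseteq C$ put $r_X=\bigcup_{g\in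 X}r_g$ and $s_X=\bigcup_{g\in X}s_g$. Association schemes. A pair $(\Omega,S)$, with $S$ a partition of $\Omega^2$, is an association scheme if the diagonal $1_\Omega=\{(\alpha,\alpha):\alpha\in\Omega\}$ belongs to $S$, $S$ is closed under $s\mapsto s^*=\{(\beta,\alpha):(\alpha,\beta)\in s\}$, and for all $r,s,t\in S$ the number $|\{\gamma:(\alpha,\gamma)\in r,\ (\gamma,\beta)\in s\}|$ does not depend on the choice of $(\alpha,\beta)\in t$. (Commutativity is not required.) $S$-rings. For a finite group $G$ and $X\subseteq G$ put $\underline{X}=\sum_{x\in X}x\in\mathbb{Z}G$ and $X^{(-1)}=\{x^{-1}:x\in X\}$. A subring $\mathcal{A}\subseteq\mathbb{Z}G$ is an $S$-ring over $G$ if there is a partition $\mathcal{S}(\mathcal{A})$ of $G$ (whose elements are called the basic sets) such that $\{e\}\in\mathcal{S}(\mathcal{A})$, $X\in\mathcal{S}(\mathcal{A})$ implies $X^{(-1)}\in\mathcal{S}(\mathcal{A})$, and $\mathcal{A}=\mathrm{Span}_{\mathbb{Z}}\{\underline{X}:X\in\mathcal{S}(\mathcal{A})\}$. A subgroup $A\le G$ is an $\mathcal{A}$-subgroup if $\underline{A}\in\mathcal{A}$. *)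

theory Defs
  imports "HOL-Algebra.Subrings" "HOL-Algebra.Generated_Groups" "HOL-Algebra.Multiplicative_Group" "HOL-Computational_Algebra.Primes"
    "HOL-Library.Disjoint_Sets" "HOL-Library.Indicator_Function"
begin

section \<open>Semidirect products\<close>

definition semidirect_product :: "('g, 'm) monoid_scheme \<Rightarrow> 'g set \<Rightarrow> 'g set \<Rightarrow> bool" where
  "semidirect_product G N H \<longleftrightarrow>
     N \<lhd> G \<and> subgroup H G \<and> N \<inter> H = {\<one>\<^bsub>G\<^esub>} \<and> N <#>\<^bsub>G\<^esub> H = carrier G"


section \<open>Integral group rings and S-rings\<close>

text \<open>The group ring over the integers of a \<^emph>\<open>finite\<close> group: a formal sum
  is represented by its coefficient function, extended by 0 outside the carrier.\<close>

definition group_ring :: "('g, 'm) monoid_scheme \<Rightarrow> ('g \<Rightarrow> int) ring" where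
  "group_ring G =
     \<lparr>carrier = {f. \<forall>x. x \<notin> carrier G \<longrightarrow> f x = 0},
      monoid.mult = (\<lambda>f h x. if x \<in> carrier G
                      then \<Sum>y\<in>carrier G. f y * h (inv\<^bsub>G\<^esub> y \<otimes>\<^bsub>G\<^esub> x) else 0),
      one = indicator {\<one>\<^bsub>G\<^esub>},
      ring.zero = (\<lambda>x. 0),
      add = (\<lambda>f h x. f x + h x)\<rparr>"

text \<open>The element of the group ring associated with a set \<open>X\<close> of group elements
  (the sum of its members) is the function \<open>indicator X\<close>.\<close>

definition int_span :: "'g set set \<Rightarrow> ('g \<Rightarrow> int) set" where
  "int_span P = {f. \<exists>c :: 'g set \<Rightarrow> int. f = (\<lambda>x. \<Sum>X\<in>P. c X * indicator X x)}"

definition basic_partition ::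
    "('g, 'm) monoid_scheme \<Rightarrow> ('g \<Rightarrow> int) set \<Rightarrow> 'g set set \<Rightarrow> bool" where
  "basic_partition G \<A> P \<longleftrightarrow>
     partition_on (carrier G) P \<and> {\<one>\<^bsub>G\<^esub>} \<in> P \<and>
     (\<forall>X\<in>P. set_inv\<^bsub>G\<^esub> X \<in> P) \<and> \<A> = int_span P"

definition s_ring :: "('g, 'm) monoid_scheme \<Rightarrow> ('g \<Rightarrow> int) set \<Rightarrow> bool" where
  "s_ring G \<A> \<longleftrightarrow> subring \<A> (group_ring G) \<and> (\<exists>P. basic_partition G \<A> P)"

text \<open>The description is justified by the lemma \<open>basic_sets_eq\<close> below.\<close>

definition basic_sets :: "('g, 'm) monoid_scheme \<Rightarrow> ('g \<Rightarrow> int) set \<Rightarrow> 'g set set" where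
  "basic_sets G \<A> = (THE P. basic_partition G \<A> P)"

definition s_ring_subgroup ::
    "('g, 'm) monoid_scheme \<Rightarrow> ('g \<Rightarrow> int) set \<Rightarrow> 'g set \<Rightarrow> bool" where
  "s_ring_subgroup G \<A> A \<longleftrightarrow> subgroup A G \<and> indicator A \<in> \<A>"

lemma partition_class_sum:
  assumes "finite \<Omega>" "partition_on \<Omega> P" "X \<in> P" "x \<in> X"
  shows "(\<Sum>Y\<in>P. c Y * indicator Y x) = (c X :: int)"
proof -
  have fin: "finite P" using assms(1,2) by (rule finite_elements)
  have "indicator Y x = (if Y = X then 1 else 0 :: int)" if "Y \<in> P" for Y
    using assms that by (auto simp: partition_on_def disjoint_def indicator_def)
  then have "(\<Sum>Y\<in>P. c Y * indicator Y x) = (\<Sum>Y\<in>P. if Y = X then c Y else 0)"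
    by (intro sum.cong) auto
  also have "\<dots> = c X" using fin assms(3) by simp
  finally show ?thesis .
qed

lemma partition_eq_int_span_classes:
  assumes "finite \<Omega>" "partition_on \<Omega> P"
  shows "P = (\<lambda>x. {y\<in>\<Omega>. \<forall>f\<in>int_span P. f y = f x}) ` \<Omega>"
proof -
  have cls: "{y\<in>\<Omega>. \<forall>f\<in>int_span P. f y = f x} = X" if X: "X \<in> P" and x: "x \<in> X" for x X
  proof (intro equalityI subsetI)
    fix y assume y: "y \<in> {y\<in>\<Omega>. \<forall>f\<in>int_span P. f y = f x}"
    then obtain Y where Y: "Y \<in> P" "y \<in> Y"
      using assms(2) by (auto simp: partition_on_def)
    let ?c = "indicator {X} :: 'a set \<Rightarrow> int"
    have "(\<lambda>x. \<Sum>Z\<in>P. ?c Z * indicator Z x) \<in> int_span P"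
      unfolding int_span_def by blast
    moreover have "\<forall>f\<in>int_span P. f y = f x" using y by simp
    ultimately have "(\<Sum>Z\<in>P. ?c Z * indicator Z y) = (\<Sum>Z\<in>P. ?c Z * indicator Z x)"
      by (rule bspec[rotated])
    then have "?c Y = ?c X"
      using partition_class_sum[OF assms Y, of ?c] partition_class_sum[OF assms X x, of ?c]
      by simp
    then have "Y = X" by (simp add: indicator_def split: if_splits)
    with Y show "y \<in> X" by simp
  next
    fix y assume y: "y \<in> X"
    then have "y \<in> \<Omega>" using X assms(2) by (auto simp: partition_on_def)
    moreover have "f y = f x" if "f \<in> int_span P" for f
      using that partition_class_sum[OF assms X y] partition_class_sum[OF assms X x]
      by (auto simp: int_span_def)
    ultimately show "y \<in> {y\<in>\<Omega>. \<forall>f\<in>int_span P. f y = f x}" by blast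
  qed
  have ex: "\<exists>x\<in>\<Omega>. x \<in> X" if "X \<in> P" for X
    using that assms(2) unfolding partition_on_def by (metis Union_iff ex_in_conv)
  show ?thesis
  proof (intro equalityI subsetI)
    fix X assume "X \<in> P"
    with ex cls show "X \<in> (\<lambda>x. {y\<in>\<Omega>. \<forall>f\<in>int_span P. f y = f x}) ` \<Omega>" by blast
  next
    fix X assume "X \<in> (\<lambda>x. {y\<in>\<Omega>. \<forall>f\<in>int_span P. f y = f x}) ` \<Omega>"
    then obtain x where x: "x \<in> \<Omega>" "X = {y\<in>\<Omega>. \<forall>f\<in>int_span P. f y = f x}" by blast
    then obtain Y where "Y \<in> P" "x \<in> Y" using assms(2) by (auto simp: partition_on_def)
    with cls x show "X \<in> P" by blast
  qed
qed

lemma basic_sets_eq: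
  assumes "finite (carrier G)" "basic_partition G \<A> P"
  shows "basic_sets G \<A> = P"
  unfolding basic_sets_def
proof (rule the_equality)
  fix Q assume "basic_partition G \<A> Q"
  then show "Q = P"
    using partition_eq_int_span_classes[OF assms(1), of P]
      partition_eq_int_span_classes[OF assms(1), of Q] assms(2)
    by (simp add: basic_partition_def)
qed (fact assms(2))


section \<open>Association schemes on a finite set\<close>

definition association_scheme :: "'p set \<Rightarrow> ('p \<times> 'p) set set \<Rightarrow> bool" where
  "association_scheme \<Omega> S \<longleftrightarrow>
     partition_on (\<Omega> \<times> \<Omega>) S \<and> Id_on \<Omega> \<in> S \<and> (\<forall>s\<in>S. s\<inverse> \<in> S) \<and>
     (\<forall>r\<in>S. \<forall>s\<in>S. \<forall>t\<in>S. \<exists>c. \<forall>(\<alpha>, \<beta>)\<in>t.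
        card {\<gamma>. (\<alpha>, \<gamma>) \<in> r \<and> (\<gamma>, \<beta>) \<in> s} = c)"


section \<open>Classes of nonzero vectors of the plane over a field\<close>

text \<open>Vectors are pairs.  The coset of \<open>a\<close> under \<open>K\<close> is \<open>K #>\<^bsub>R\<^esub> a\<close>, taken in the multiplicative
  monoid of the field, so that it also makes sense for \<open>a = \<zero>\<close>, where it is \<open>{\<zero>}\<close>;
  the latter plays the role of the extra value 0 of the form on \<open>\<Omega>\<close>.\<close>

definition vec_scale :: "('f, 'm) ring_scheme \<Rightarrow> 'f \<Rightarrow> 'f \<times> 'f \<Rightarrow> 'f \<times> 'f" where
  "vec_scale R x v = (x \<otimes>\<^bsub>R\<^esub> fst v, x \<otimes>\<^bsub>R\<^esub> snd v)"

definition vec_det :: "('f, 'm) ring_scheme \<Rightarrow> 'f \<times> 'f \<Rightarrow> 'f \<times> 'f \<Rightarrow> 'f" where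
  "vec_det R u v = fst u \<otimes>\<^bsub>R\<^esub> snd v \<ominus>\<^bsub>R\<^esub> snd u \<otimes>\<^bsub>R\<^esub> fst v"

definition nonzero_vecs :: "('f, 'm) ring_scheme \<Rightarrow> ('f \<times> 'f) set" where
  "nonzero_vecs R = carrier R \<times> carrier R - {(\<zero>\<^bsub>R\<^esub>, \<zero>\<^bsub>R\<^esub>)}"

definition vec_class :: "('f, 'm) ring_scheme \<Rightarrow> 'f set \<Rightarrow> 'f \<times> 'f \<Rightarrow> ('f \<times> 'f) set" where
  "vec_class R K v = {vec_scale R x v | x. x \<in> K}"

definition Omega :: "('f, 'm) ring_scheme \<Rightarrow> 'f set \<Rightarrow> ('f \<times> 'f) set set" where
  "Omega R K = {vec_class R K v | v. v \<in> nonzero_vecs R}"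

text \<open>The action of cosets and the form are defined elementwise; the lemmas \<open>class_act_coset\<close>
  and \<open>class_form_coset\<close> give them in terms of representatives.\<close>

definition class_act :: "('f, 'm) ring_scheme \<Rightarrow> 'f set \<Rightarrow> ('f \<times> 'f) set \<Rightarrow> ('f \<times> 'f) set" where
  "class_act R g \<alpha> = {vec_scale R y v | y v. y \<in> g \<and> v \<in> \<alpha>}"

definition class_form :: "('f, 'm) ring_scheme \<Rightarrow> ('f \<times> 'f) set \<Rightarrow> ('f \<times> 'f) set \<Rightarrow> 'f set" where
  "class_form R \<alpha> \<beta> = {vec_det R u v | u v. u \<in> \<alpha> \<and> v \<in> \<beta>}"

definition r_rel ::
    "('f, 'm) ring_scheme \<Rightarrow> 'f set \<Rightarrow> 'f set \<Rightarrow> (('f \<times> 'f) set \<times> ('f \<times> 'f) set) set" where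
  "r_rel R K g = {(\<alpha>, \<beta>) \<in> Omega R K \<times> Omega R K. \<beta> = class_act R g \<alpha>}"

definition s_rel ::
    "('f, 'm) ring_scheme \<Rightarrow> 'f set \<Rightarrow> 'f set \<Rightarrow> (('f \<times> 'f) set \<times> ('f \<times> 'f) set) set" where
  "s_rel R K g = {(\<alpha>, \<beta>) \<in> Omega R K \<times> Omega R K. class_form R \<alpha> \<beta> = g}"

context field
begin

lemma class_act_coset:
  assumes K: "subgroup K (mult_of R)" and y: "y \<in> carrier R" and v: "v \<in> carrier R \<times> carrier R"
  shows "class_act R (K #> y) (vec_class R K v) = vec_class R K (vec_scale R y v)"
proof -
  have KR: "x \<in> carrier R" if "x \<in> K" for x
    using subgroup.subset[OF K] that by auto
  have Km: "x \<otimes> z \<in> K" if "x \<in> K" "z \<in> K" for x z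
    using subgroup.m_closed[OF K] that by simp
  have K1: "\<one> \<in> K" using subgroup.one_closed[OF K] by simp
  have vR: "fst v \<in> carrier R" "snd v \<in> carrier R" using v by auto
  have eq: "vec_scale R (x \<otimes> y) (vec_scale R z v) = vec_scale R (x \<otimes> z) (vec_scale R y v)"
    if "x \<in> K" "z \<in> K" for x z
    using KR[OF that(1)] KR[OF that(2)] y vR by (simp add: vec_scale_def m_ac)
  show ?thesis
  proof (intro equalityI subsetI)
    fix w assume "w \<in> class_act R (K #> y) (vec_class R K v)"
    then obtain x z where "x \<in> K" "z \<in> K" "w = vec_scale R (x \<otimes> y) (vec_scale R z v)"
      by (auto simp: class_act_def vec_class_def r_coset_def)
    then show "w \<in> vec_class R K (vec_scale R y v)"
      using eq Km by (auto simp: vec_class_def)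
  next
    fix w assume "w \<in> vec_class R K (vec_scale R y v)"
    then obtain x where x: "x \<in> K" "w = vec_scale R x (vec_scale R y v)"
      by (auto simp: vec_class_def)
    then have "w = vec_scale R (x \<otimes> y) (vec_scale R \<one> v)"
      using eq[OF x(1) K1] KR by simp
    then show "w \<in> class_act R (K #> y) (vec_class R K v)"
      using x(1) K1 unfolding class_act_def vec_class_def r_coset_def by blast
  qed
qed

lemma class_form_coset:
  assumes K: "subgroup K (mult_of R)"
    and u: "u \<in> carrier R \<times> carrier R" and v: "v \<in> carrier R \<times> carrier R"
  shows "class_form R (vec_class R K u) (vec_class R K v) = K #> vec_det R u v"
proof -
  have KR: "x \<in> carrier R" if "x \<in> K" for x
    using subgroup.subset[OF K] that by auto
  have Km: "x \<otimes> z \<in> K" if "x \<in> K" "z \<in> K" for x z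
    using subgroup.m_closed[OF K] that by simp
  have K1: "\<one> \<in> K" using subgroup.one_closed[OF K] by simp
  have uvR: "fst u \<in> carrier R" "snd u \<in> carrier R" "fst v \<in> carrier R" "snd v \<in> carrier R"
    using u v by auto
  have eq: "vec_det R (vec_scale R x u) (vec_scale R z v) = (x \<otimes> z) \<otimes> vec_det R u v"
    if "x \<in> K" "z \<in> K" for x z
    using KR[OF that(1)] KR[OF that(2)] uvR
    by (simp add: vec_scale_def vec_det_def a_minus_def r_distr r_minus m_ac)
  show ?thesis
  proof (intro equalityI subsetI)
    fix w assume "w \<in> class_form R (vec_class R K u) (vec_class R K v)"
    then obtain x z where "x \<in> K" "z \<in> K" "w = vec_det R (vec_scale R x u) (vec_scale R z v)"
      by (auto simp: class_form_def vec_class_def)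
    then show "w \<in> K #> vec_det R u v"
      using eq Km by (auto simp: r_coset_def)
  next
    fix w assume "w \<in> K #> vec_det R u v"
    then obtain x where x: "x \<in> K" "w = x \<otimes> vec_det R u v"
      by (auto simp: r_coset_def)
    then have "w = vec_det R (vec_scale R x u) (vec_scale R \<one> v)"
      using eq[OF x(1) K1] KR by simp
    then show "w \<in> class_form R (vec_class R K u) (vec_class R K v)"
      using x(1) K1 unfolding class_form_def vec_class_def by blast
  qed
qed

end


section \<open>The scheme of an S-ring\<close>

text \<open>\<open>\<iota>\<close> is the embedding of the quotient group \<open>C = mult_of R Mod K\<close> into \<open>G\<close>.\<close>

definition scheme_of ::
    "('f, 'n) ring_scheme \<Rightarrow> 'f set \<Rightarrow> ('g, 'm) monoid_scheme \<Rightarrow> ('f set \<Rightarrow> 'g) \<Rightarrow> 'g \<Rightarrow>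
     ('g \<Rightarrow> int) set \<Rightarrow> (('f \<times> 'f) set \<times> ('f \<times> 'f) set) set set" where
  "scheme_of R K G \<iota> b \<A> =
     {\<Union>g\<in>X. r_rel R K g | X.
        X \<subseteq> carrier (mult_of R Mod K) \<and> \<iota> ` X \<in> basic_sets G \<A>} \<union>
     {\<Union>g\<in>Y. s_rel R K g | Y.
        Y \<subseteq> carrier (mult_of R Mod K) \<and> b <#\<^bsub>G\<^esub> (\<iota> ` Y) \<in> basic_sets G \<A>}"

end

theory Submission
  imports Defs
begin

text \<open>The relations \<open>r_g\<close> and \<open>s_g\<close> on the classes of nonzero vectors can be labelled by the elements of the
generalized dihedral group \<open>G\<close>: the rotation \<open>g\<close> labels \<open>r_g\<close> and the reflection \<open>b g\<close> labels \<open>s_g\<close>.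
Write \<open>R_g\<close> and \<open>S_g\<close> for the adjacency matrices, and \<open>q\<close> for the order of the field.  Elementary
linear algebra in the plane gives

  \<open>R_g R_h = R_{g h}\<close>, \<open>R_g S_h = S_{g' h}\<close>, \<open>S_g R_h = S_{g h}\<close>,
  \<open>S_g S_h = q R_{g' h} + |K| (sum of all S_t)\<close>, where \<open>g'\<close> is the inverse of \<open>g\<close>.

In \<open>G\<close> one has \<open>g (b h) = b (g' h)\<close>, \<open>(b g) h = b (g h)\<close> and \<open>(b g) (b h) = g' h\<close>.  Hence the matrices
multiply like the group elements, except that a product of two reflections carries the factor \<open>q\<close> and
is perturbed by \<open>|K|\<close> times the sum of all reflections (\<open>card_colour_rel\<close>).  When the relations are
merged along the basic sets of an S-ring for which \<open>C\<close> is a union of basic sets, this deviation does no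
harm: each basic set consists only of rotations or only of reflections, so the factor is constant
on a pair of basic sets, and the perturbation is a combination of merged relations.  The structure
constants of the S-ring thus give those of the scheme (\<open>association_scheme_fusion\<close>).

The product \<open>S_g S_h\<close> is the one that requires a count, done in \<open>card_s_s\<close>.  The parity hypothesis
enters by way of \<open>- 1 \<in> K\<close> (\<open>minus_one_in_subgroup\<close>), which makes the form symmetric; this
corresponds to the fact that reflections are involutions.\<close>

section \<open>Merging relations along an S-ring\<close>

lemma basic_set_closed:
  assumes "finite (carrier G)" "basic_partition G \<A> P" "X \<in> P"
  shows "indicator X \<in> \<A>"
proof -
  have part: "partition_on (carrier G) P" and span: "\<A> = int_span P"
    using assms(2) by (auto simp: basic_partition_def)
  have "finite P" using finite_elements[OF assms(1) part] .
  have "(\<Sum>Y\<in>P. of_bool (Y = X) * indicator Y x) = (indicator X x :: int)" for x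
    using sum.delta[OF \<open>finite P\<close>, of X "\<lambda>Y. indicator Y x :: int"] assms(3)
    by (simp add: of_bool_def if_distrib[of "\<lambda>a. a * _"] cong: if_cong)
  then have "indicator X = (\<lambda>x. \<Sum>Y\<in>P. of_bool (Y = X) * indicator Y x :: int)" by simp
  then show ?thesis unfolding span int_span_def mem_Collect_eq
    by (intro exI[of _ "\<lambda>Y. of_bool (Y = X)"])
qed

lemma constant_on_basic_set:
  assumes "finite (carrier G)" "basic_partition G \<A> P" "X \<in> P" "f \<in> \<A>" "x \<in> X" "y \<in> X"
  shows "f x = f y"
proof -
  have part: "partition_on (carrier G) P" and span: "\<A> = int_span P"
    using assms(2) by (auto simp: basic_partition_def)
  obtain c where "f = (\<lambda>x. \<Sum>X\<in>P. c X * indicator X x)"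
    using assms(4) span by (auto simp: int_span_def)
  then show ?thesis
    using partition_class_sum[OF assms(1) part assms(3)] assms(5,6) by simp
qed

lemma (in group) group_ring_mult_indicator:
  assumes fin: "finite (carrier G)" and X: "X \<subseteq> carrier G" and Y: "Y \<subseteq> carrier G"
    and z: "z \<in> carrier G"
  shows "(indicator X \<otimes>\<^bsub>group_ring G\<^esub> indicator Y) z =
    int (card {(x, y) \<in> X \<times> Y. x \<otimes> y = z})"
proof -
  have "fst ` {(x, y) \<in> X \<times> Y. x \<otimes> y = z} = {x \<in> X. inv x \<otimes> z \<in> Y}"
  proof (intro equalityI subsetI)
    fix x assume "x \<in> fst ` {(x, y) \<in> X \<times> Y. x \<otimes> y = z}"
    then obtain y where xy: "x \<in> X" "y \<in> Y" "z = x \<otimes> y" by auto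
    then have "inv x \<otimes> z = y" using X Y by (simp add: subset_iff inv_solve_left')
    with xy show "x \<in> {x \<in> X. inv x \<otimes> z \<in> Y}" by simp
  next
    fix x assume "x \<in> {x \<in> X. inv x \<otimes> z \<in> Y}"
    then have x: "x \<in> X" "inv x \<otimes> z \<in> Y" by auto
    have "x \<in> carrier G" using x(1) X by blast
    then have "x \<otimes> (inv x \<otimes> z) = z" using z by (simp add: m_assoc[symmetric])
    with x show "x \<in> fst ` {(x, y) \<in> X \<times> Y. x \<otimes> y = z}" by force
  qed
  note fst_img = this
  have "inj_on fst {(x, y) \<in> X \<times> Y. x \<otimes> y = z}"
  proof (rule inj_onI)
    fix p p' assume p: "p \<in> {(x, y) \<in> X \<times> Y. x \<otimes> y = z}" "p' \<in> {(x, y) \<in> X \<times> Y. x \<otimes> y = z}"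
      and eq: "fst p = fst p'"
    obtain x y y' where e: "p = (x, y)" "p' = (x, y')" using eq by (metis prod.collapse)
    have "x \<otimes> y = x \<otimes> y'" using p e by simp
    moreover have "x \<in> carrier G" "y \<in> carrier G" "y' \<in> carrier G" using p e X Y by auto
    ultimately show "p = p'" using e by simp
  qed
  from card_image[OF this]
  have "card {(x, y) \<in> X \<times> Y. x \<otimes> y = z} = card {x \<in> X. inv x \<otimes> z \<in> Y}"
    unfolding fst_img by (rule sym)
  moreover have "(indicator X \<otimes>\<^bsub>group_ring G\<^esub> indicator Y) z =
      (\<Sum>x\<in>carrier G. of_bool (x \<in> X \<and> inv x \<otimes> z \<in> Y) :: int)"
    using z by (auto simp: group_ring_def indicator_def intro!: sum.cong)
  moreover have "carrier G \<inter> {x. x \<in> X \<and> inv x \<otimes> z \<in> Y} = {x \<in> X. inv x \<otimes> z \<in> Y}"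
    using X by blast
  ultimately show ?thesis using fin by (simp add: sum_of_bool_eq)
qed

text \<open>The values \<open>w\<close> and \<open>c\<close> depend on \<open>x\<close>, \<open>y\<close>, \<open>z\<close> only through their membership in \<open>D\<close>, and \<open>D\<close> is
a union of basic sets, so on a triple of basic sets they are constants.  Adding the intersection
numbers over \<open>x \<in> X\<close> and \<open>y \<in> Y\<close> therefore gives a linear combination of the coefficient of \<open>z\<close> in
the product of the sums of \<open>X\<close> and \<open>Y\<close>, which is the same for all \<open>z\<close> in a basic set because the
S-ring is closed under multiplication, and of the fixed number \<open>card X * card Y\<close>.  The case \<open>w = 1\<close>,
\<open>c = 0\<close> is the usual passage from an S-ring to a Cayley scheme; the extra
weights allow for relations whose adjacency matrices multiply only almost like the group elements.\<close>

lemma (in group) association_scheme_fusion: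
  fixes \<rho> :: "'a \<Rightarrow> ('p \<times> 'p) set"
  assumes finG: "finite (carrier G)" and fin: "finite \<Omega>"
    and ring: "subring \<A> (group_ring G)" and P: "basic_partition G \<A> P"
    and D: "D \<subseteq> carrier G" "indicator D \<in> \<A>"
    and part: "partition_on (\<Omega> \<times> \<Omega>) (\<rho> ` carrier G)" and inj: "inj_on \<rho> (carrier G)"
    and one: "\<rho> \<one> = Id_on \<Omega>"
    and converse: "\<And>x. x \<in> carrier G \<Longrightarrow> (\<rho> x)\<inverse> = \<rho> (inv x)"
    and prod: "\<And>x y z \<alpha> \<beta>. \<lbrakk>x \<in> carrier G; y \<in> carrier G; z \<in> carrier G; (\<alpha>, \<beta>) \<in> \<rho> z\<rbrakk> \<Longrightarrow>
      card {\<gamma>. (\<alpha>, \<gamma>) \<in> \<rho> x \<and> (\<gamma>, \<beta>) \<in> \<rho> y} =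
        w (x \<in> D) (y \<in> D) * of_bool (x \<otimes> y = z) + c (x \<in> D) (y \<in> D) (z \<in> D)"
  shows "association_scheme \<Omega> ((\<lambda>X. \<Union>x\<in>X. \<rho> x) ` P)"
proof -
  let ?S = "\<lambda>X. \<Union>x\<in>X. \<rho> x"
  have partP: "partition_on (carrier G) P" and P1: "{\<one>} \<in> P"
    and Pinv: "\<And>X. X \<in> P \<Longrightarrow> set_inv X \<in> P"
    using P by (auto simp: basic_partition_def)
  have sub: "X \<subseteq> carrier G" if "X \<in> P" for X
    using that partP by (auto simp: partition_on_def)
  have P_ne: "X \<noteq> {}" if "X \<in> P" for X
    using that partP by (auto simp: partition_on_def)
  have finX: "finite X" if "X \<in> P" for X
    using sub[OF that] finG finite_subset by blast
  have \<rho>_sub: "\<rho> x \<subseteq> \<Omega> \<times> \<Omega>" if "x \<in> carrier G" for x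
    using part that by (auto simp: partition_on_def)
  have \<rho>_ne: "\<rho> x \<noteq> {}" if "x \<in> carrier G" for x
    using part that by (auto simp: partition_on_def)
  have unique: "x = y" if "x \<in> carrier G" "y \<in> carrier G" "p \<in> \<rho> x" "p \<in> \<rho> y" for x y p
  proof -
    have "disjoint (\<rho> ` carrier G)" using part by (simp add: partition_on_def)
    then have "\<rho> x = \<rho> y" using that by (auto simp: disjoint_def)
    with inj show ?thesis using that by (simp add: inj_on_eq_iff)
  qed
  have "partition_on (\<Omega> \<times> \<Omega>) (?S ` P)"
    unfolding partition_on_def
  proof (intro conjI)
    have "\<Union> (?S ` P) = (\<Union>x\<in>\<Union>P. \<rho> x)" by blast
    also have "\<dots> = \<Omega> \<times> \<Omega>" using part partP by (simp add: partition_on_def)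
    finally show "\<Union> (?S ` P) = \<Omega> \<times> \<Omega>" .
    show "disjoint (?S ` P)"
    proof (rule disjointI)
      fix S T assume "S \<in> ?S ` P" "T \<in> ?S ` P" "S \<noteq> T"
      then obtain X Y where XY: "X \<in> P" "Y \<in> P" "S = ?S X" "T = ?S Y" "X \<noteq> Y" by blast
      then have "X \<inter> Y = {}" using partP by (simp add: partition_on_def disjoint_def)
      then show "S \<inter> T = {}" using unique sub[OF XY(1)] sub[OF XY(2)] XY(3,4) by blast
    qed
    have "?S X \<noteq> {}" if X: "X \<in> P" for X
    proof -
      obtain x where "x \<in> X" using P_ne[OF X] by blast
      then show ?thesis using \<rho>_ne sub[OF X] by blast
    qed
    then show "{} \<notin> ?S ` P" by blast
  qed
  moreover have "Id_on \<Omega> \<in> ?S ` P" using one by (intro image_eqI[OF _ P1]) simp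
  moreover have "\<forall>s\<in>?S ` P. s\<inverse> \<in> ?S ` P"
  proof (intro ballI)
    fix s assume "s \<in> ?S ` P"
    then obtain X where X: "X \<in> P" "s = ?S X" by blast
    then have "s\<inverse> = (\<Union>x\<in>X. (\<rho> x)\<inverse>)" by blast
    also have "\<dots> = (\<Union>x\<in>X. \<rho> (inv x))" using converse sub[OF X(1)] by blast
    also have "\<dots> = ?S (set_inv X)" by (auto simp: SET_INV_def)
    finally show "s\<inverse> \<in> ?S ` P" using Pinv[OF X(1)] by blast
  qed
  moreover have "\<exists>m. \<forall>(\<alpha>, \<beta>)\<in>?S Z. card {\<gamma>. (\<alpha>, \<gamma>) \<in> ?S X \<and> (\<gamma>, \<beta>) \<in> ?S Y} = m"
    if X: "X \<in> P" and Y: "Y \<in> P" and Z: "Z \<in> P" for X Y Z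
  proof -
    obtain x0 where x0: "x0 \<in> X" using P_ne[OF X] by blast
    obtain y0 where y0: "y0 \<in> Y" using P_ne[OF Y] by blast
    obtain z0 where z0: "z0 \<in> Z" using P_ne[OF Z] by blast
    have inD: "x \<in> D \<longleftrightarrow> x' \<in> D" if "V \<in> P" "x \<in> V" "x' \<in> V" for V x x'
      using constant_on_basic_set[OF finG P that(1) D(2) that(2,3)]
      by (cases "x \<in> D"; cases "x' \<in> D") simp_all
    let ?w = "w (x0 \<in> D) (y0 \<in> D)" and ?c = "c (x0 \<in> D) (y0 \<in> D) (z0 \<in> D)"
    have "indicator X \<otimes>\<^bsub>group_ring G\<^esub> indicator Y \<in> \<A>"
      using subringE(6)[OF ring] basic_set_closed[OF finG P] X Y by blast
    note const = constant_on_basic_set[OF finG P Z this]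
    have conv: "card {(x, y) \<in> X \<times> Y. x \<otimes> y = z} = card {(x, y) \<in> X \<times> Y. x \<otimes> y = z0}"
      if z: "z \<in> Z" for z
    proof -
      have "z \<in> carrier G" "z0 \<in> carrier G" using z z0 sub[OF Z] by auto
      then show ?thesis
        using const[OF z z0]
        by (simp add: group_ring_mult_indicator[OF finG sub[OF X] sub[OF Y]])
    qed
    have "card {\<gamma>. (\<alpha>, \<gamma>) \<in> ?S X \<and> (\<gamma>, \<beta>) \<in> ?S Y} =
      ?w * card {(x, y) \<in> X \<times> Y. x \<otimes> y = z0} + card X * card Y * ?c"
      if ab: "(\<alpha>, \<beta>) \<in> ?S Z" for \<alpha> \<beta>
    proof -
      obtain z where z: "z \<in> Z" "(\<alpha>, \<beta>) \<in> \<rho> z" using ab by blast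
      define M where "M = (\<lambda>(x, y). {\<gamma>. (\<alpha>, \<gamma>) \<in> \<rho> x \<and> (\<gamma>, \<beta>) \<in> \<rho> y})"
      have finM: "finite (M p)" if "p \<in> X \<times> Y" for p
      proof (rule finite_subset[OF _ fin])
        show "M p \<subseteq> \<Omega>" using that sub[OF X] \<rho>_sub by (auto simp: M_def)
      qed
      have "{\<gamma>. (\<alpha>, \<gamma>) \<in> ?S X \<and> (\<gamma>, \<beta>) \<in> ?S Y} = (\<Union>p\<in>X \<times> Y. M p)"
        by (auto simp: M_def)
      also have "card \<dots> = (\<Sum>p\<in>X \<times> Y. card (M p))"
      proof (rule card_UN_disjoint)
        show "finite (X \<times> Y)" using finX X Y by blast
        show "\<forall>p\<in>X \<times> Y. finite (M p)" using finM by blast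
        show "\<forall>p\<in>X \<times> Y. \<forall>p'\<in>X \<times> Y. p \<noteq> p' \<longrightarrow> M p \<inter> M p' = {}"
        proof (intro ballI impI equals0I)
          fix p p' \<gamma> assume p: "p \<in> X \<times> Y" "p' \<in> X \<times> Y" "p \<noteq> p'" "\<gamma> \<in> M p \<inter> M p'"
          have "fst p = fst p'" using p sub[OF X] by (intro unique[of _ _ "(\<alpha>, \<gamma>)"]) (auto simp: M_def)
          moreover have "snd p = snd p'" using p sub[OF Y] by (intro unique[of _ _ "(\<gamma>, \<beta>)"]) (auto simp: M_def)
          ultimately show False using p(3) by (simp add: prod_eq_iff)
        qed
      qed
      also have "\<dots> = (\<Sum>p\<in>X \<times> Y. ?w * of_bool (fst p \<otimes> snd p = z) + ?c)"
      proof (rule sum.cong[OF refl])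
        fix p assume "p \<in> X \<times> Y"
        then obtain x y where p: "p = (x, y)" "x \<in> X" "y \<in> Y" by blast
        have "card (M p) = w (x \<in> D) (y \<in> D) * of_bool (x \<otimes> y = z) + c (x \<in> D) (y \<in> D) (z \<in> D)"
          unfolding M_def p(1) prod.case
          using sub X Y Z p(2,3) z by (intro prod) auto
        then show "card (M p) = ?w * of_bool (fst p \<otimes> snd p = z) + ?c"
          using inD[OF X p(2) x0] inD[OF Y p(3) y0] inD[OF Z z(1) z0] p(1) by simp
      qed
      also have "\<dots> = ?w * card {(x, y) \<in> X \<times> Y. x \<otimes> y = z} + card X * card Y * ?c"
      proof -
        have "(X \<times> Y) \<inter> {p. fst p \<otimes> snd p = z} = {(x, y) \<in> X \<times> Y. x \<otimes> y = z}" by auto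
        then show ?thesis
          using finX X Y by (simp add: sum.distrib sum_distrib_left[symmetric] sum_of_bool_eq card_cartesian_product)
      qed
      finally show ?thesis using conv[OF z(1)] by simp
    qed
    then show ?thesis by blast
  qed
  ultimately show ?thesis unfolding association_scheme_def by blast
qed

section \<open>Vectors and determinants in the plane\<close>

definition vec_add :: "('f, 'm) ring_scheme \<Rightarrow> 'f \<times> 'f \<Rightarrow> 'f \<times> 'f \<Rightarrow> 'f \<times> 'f" where
  "vec_add R u v = (fst u \<oplus>\<^bsub>R\<^esub> fst v, snd u \<oplus>\<^bsub>R\<^esub> snd v)"

context field
begin

lemma vec_scale_closed [simp]:
  "c \<in> carrier R \<Longrightarrow> u \<in> carrier R \<times> carrier R \<Longrightarrow> vec_scale R c u \<in> carrier R \<times> carrier R"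
  by (auto simp: vec_scale_def)

lemma vec_add_closed [simp]:
  "u \<in> carrier R \<times> carrier R \<Longrightarrow> v \<in> carrier R \<times> carrier R \<Longrightarrow> vec_add R u v \<in> carrier R \<times> carrier R"
  by (auto simp: vec_add_def)

lemma vec_det_closed [simp]:
  "u \<in> carrier R \<times> carrier R \<Longrightarrow> v \<in> carrier R \<times> carrier R \<Longrightarrow> vec_det R u v \<in> carrier R"
  by (auto simp: vec_det_def)

lemma vec_scale_scale:
  "c \<in> carrier R \<Longrightarrow> d \<in> carrier R \<Longrightarrow> u \<in> carrier R \<times> carrier R \<Longrightarrow>
    vec_scale R c (vec_scale R d u) = vec_scale R (c \<otimes> d) u"
  by (auto simp: vec_scale_def m_assoc)

lemma vec_scale_one [simp]: "u \<in> carrier R \<times> carrier R \<Longrightarrow> vec_scale R \<one> u = u"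
  by (auto simp: vec_scale_def)

lemma nonzero_vecs_carrier: "u \<in> nonzero_vecs R \<Longrightarrow> u \<in> carrier R \<times> carrier R"
  by (simp add: nonzero_vecs_def)

lemma vec_scale_nonzero:
  "c \<in> carrier R \<Longrightarrow> c \<noteq> \<zero> \<Longrightarrow> u \<in> nonzero_vecs R \<Longrightarrow> vec_scale R c u \<in> nonzero_vecs R"
  by (auto simp: vec_scale_def nonzero_vecs_def integral_iff)

lemma vec_scale_cancel:
  assumes "c \<in> carrier R" "d \<in> carrier R" "u \<in> nonzero_vecs R" "vec_scale R c u = vec_scale R d u"
  shows "c = d"
proof -
  obtain a b where u: "u = (a, b)" by force
  then have "c \<otimes> a = d \<otimes> a" "c \<otimes> b = d \<otimes> b" using assms(4) by (auto simp: vec_scale_def)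
  moreover have "a \<in> carrier R" "b \<in> carrier R" "a \<noteq> \<zero> \<or> b \<noteq> \<zero>"
    using assms(3) u by (auto simp: nonzero_vecs_def)
  ultimately show ?thesis using assms(1,2) m_rcancel by metis
qed

lemma vec_det_scale:
  assumes "c \<in> carrier R" "u \<in> carrier R \<times> carrier R" "v \<in> carrier R \<times> carrier R"
  shows "vec_det R (vec_scale R c u) v = c \<otimes> vec_det R u v"
    and "vec_det R u (vec_scale R c v) = c \<otimes> vec_det R u v"
proof -
  obtain u1 u2 v1 v2 where e: "u = (u1, u2)" "v = (v1, v2)" by (metis surj_pair)
  have "u1 \<in> carrier R" "u2 \<in> carrier R" "v1 \<in> carrier R" "v2 \<in> carrier R" using assms e by auto
  with assms(1) show "vec_det R (vec_scale R c u) v = c \<otimes> vec_det R u v"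
      "vec_det R u (vec_scale R c v) = c \<otimes> vec_det R u v"
    unfolding vec_det_def vec_scale_def e fst_conv snd_conv by algebra+
qed

lemma vec_det_add:
  assumes "u \<in> carrier R \<times> carrier R" "v \<in> carrier R \<times> carrier R" "w \<in> carrier R \<times> carrier R"
  shows "vec_det R (vec_add R u w) v = vec_det R u v \<oplus> vec_det R w v"
    and "vec_det R u (vec_add R v w) = vec_det R u v \<oplus> vec_det R u w"
proof -
  obtain u1 u2 v1 v2 w1 w2 where e: "u = (u1, u2)" "v = (v1, v2)" "w = (w1, w2)"
    by (metis surj_pair)
  have "u1 \<in> carrier R" "u2 \<in> carrier R" "v1 \<in> carrier R" "v2 \<in> carrier R"
    "w1 \<in> carrier R" "w2 \<in> carrier R" using assms e by auto
  then show "vec_det R (vec_add R u w) v = vec_det R u v \<oplus> vec_det R w v"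
      "vec_det R u (vec_add R v w) = vec_det R u v \<oplus> vec_det R u w"
    unfolding vec_det_def vec_add_def e fst_conv snd_conv by algebra+
qed

lemma vec_det_self [simp]: "u \<in> carrier R \<times> carrier R \<Longrightarrow> vec_det R u u = \<zero>"
  by (auto simp: vec_det_def m_comm r_right_minus_eq)

lemma vec_det_swap:
  assumes "u \<in> carrier R \<times> carrier R" "v \<in> carrier R \<times> carrier R"
  shows "vec_det R v u = \<ominus> vec_det R u v"
proof -
  obtain u1 u2 v1 v2 where e: "u = (u1, u2)" "v = (v1, v2)" by (metis surj_pair)
  have "u1 \<in> carrier R" "u2 \<in> carrier R" "v1 \<in> carrier R" "v2 \<in> carrier R" using assms e by auto
  then show ?thesis
    unfolding vec_det_def e fst_conv snd_conv by algebra
qed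

text \<open>Every nonzero vector is half of a symplectic basis.  In such a basis the coordinates of a vector are
determinants, by Cramer's rule (\<open>vec_expansion\<close>).\<close>

lemma ex_vec_det_one:
  assumes "u \<in> nonzero_vecs R"
  obtains w where "w \<in> carrier R \<times> carrier R" "vec_det R u w = \<one>"
proof -
  obtain a b where u: "u = (a, b)" by force
  then have ab: "a \<in> carrier R" "b \<in> carrier R" "a \<noteq> \<zero> \<or> b \<noteq> \<zero>"
    using assms by (auto simp: nonzero_vecs_def)
  show ?thesis
  proof (cases "a = \<zero>")
    case False
    then have a: "a \<in> Units R" using ab by (simp add: field_Units)
    then have "vec_det R u (\<zero>, inv a) = \<one>" using ab by (simp add: vec_det_def u a_minus_def)
    with a show ?thesis by (intro that[of "(\<zero>, inv a)"]) auto
  next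
    case True
    then have b: "b \<in> Units R" using ab by (simp add: field_Units)
    then have "vec_det R u (\<ominus> (inv b), \<zero>) = \<one>"
      using ab by (simp add: vec_det_def u a_minus_def r_minus)
    with b show ?thesis by (intro that[of "(\<ominus> (inv b), \<zero>)"]) auto
  qed
qed

lemma vec_expansion:
  assumes "u \<in> carrier R \<times> carrier R" "v \<in> carrier R \<times> carrier R" "w \<in> carrier R \<times> carrier R"
    and "vec_det R u v = \<one>"
  shows "w = vec_add R (vec_scale R (vec_det R u w) v) (vec_scale R (vec_det R w v) u)"
proof -
  obtain u1 u2 v1 v2 w1 w2 where e: "u = (u1, u2)" "v = (v1, v2)" "w = (w1, w2)"
    by (metis surj_pair)
  have c: "u1 \<in> carrier R" "u2 \<in> carrier R" "v1 \<in> carrier R" "v2 \<in> carrier R"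
    "w1 \<in> carrier R" "w2 \<in> carrier R" using assms e by auto
  have d: "u1 \<otimes> v2 \<ominus> u2 \<otimes> v1 = \<one>" using assms(4) by (simp add: vec_det_def e)
  have "(u1 \<otimes> w2 \<ominus> u2 \<otimes> w1) \<otimes> v1 \<oplus> (w1 \<otimes> v2 \<ominus> w2 \<otimes> v1) \<otimes> u1 = (u1 \<otimes> v2 \<ominus> u2 \<otimes> v1) \<otimes> w1"
    using c by algebra
  moreover have
    "(u1 \<otimes> w2 \<ominus> u2 \<otimes> w1) \<otimes> v2 \<oplus> (w1 \<otimes> v2 \<ominus> w2 \<otimes> v1) \<otimes> u2 = (u1 \<otimes> v2 \<ominus> u2 \<otimes> v1) \<otimes> w2"
    using c by algebra
  ultimately show ?thesis using c d by (simp add: vec_det_def vec_add_def vec_scale_def e)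
qed

lemma vec_det_zeroD:
  assumes "u \<in> nonzero_vecs R" "v \<in> nonzero_vecs R" "vec_det R u v = \<zero>"
  obtains c where "c \<in> carrier R" "c \<noteq> \<zero>" "v = vec_scale R c u"
proof -
  have uv: "u \<in> carrier R \<times> carrier R" "v \<in> carrier R \<times> carrier R"
    using assms by (auto simp: nonzero_vecs_def)
  obtain w where w: "w \<in> carrier R \<times> carrier R" "vec_det R u w = \<one>"
    using ex_vec_det_one[OF assms(1)] .
  let ?c = "vec_det R v w"
  have "v = vec_scale R ?c u"
    using vec_expansion[OF uv(1) w(1) uv(2) w(2)] assms(3) uv w
    by (auto simp: vec_add_def vec_scale_def)
  moreover have "?c \<noteq> \<zero>"
  proof
    assume "?c = \<zero>"
    with \<open>v = vec_scale R ?c u\<close> uv have "v = (\<zero>, \<zero>)" by (auto simp: vec_scale_def)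
    with assms(2) show False by (simp add: nonzero_vecs_def)
  qed
  ultimately show ?thesis using that[of ?c] uv w by simp
qed

end

section \<open>Cosets of scalars and classes of vectors\<close>

locale plane_classes = field R for R (structure) +
  fixes K
  assumes finite_carrier: "finite (carrier R)"
    and K_subgroup: "subgroup K (mult_of R)"
begin

abbreviation C where "C \<equiv> mult_of R Mod K"

lemma comm_group_mult_of: "comm_group (mult_of R)"
  by (rule group.group_comm_groupI[OF field_mult_group]) (simp add: m_comm)

lemma normal_K: "K \<lhd> mult_of R"
  using comm_group.normal_iff_subgroup[OF comm_group_mult_of] K_subgroup by blast

lemma group_C: "group C"
  using normal.factorgroup_is_group[OF normal_K] .

lemma K_nonzero: "k \<in> K \<Longrightarrow> k \<in> carrier R \<and> k \<noteq> \<zero>"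
  using subgroup.subset[OF K_subgroup] by auto

lemma K_mult: "k \<in> K \<Longrightarrow> l \<in> K \<Longrightarrow> k \<otimes> l \<in> K"
  using subgroup.m_closed[OF K_subgroup] by simp

lemma K_one: "\<one> \<in> K"
  using subgroup.one_closed[OF K_subgroup] by simp

lemma K_inv: "k \<in> K \<Longrightarrow> inv k \<in> K"
  using subgroup.m_inv_closed[OF K_subgroup, of k] K_nonzero[of k] by (simp add: m_inv_mult_of)

lemma r_coset_mult_of [simp]: "K #>\<^bsub>mult_of R\<^esub> y = K #> y"
  by (simp add: r_coset_def)

lemma coset_cases:
  assumes "g \<in> carrier C"
  obtains y where "y \<in> carrier R" "y \<noteq> \<zero>" "g = K #> y"
  using assms by (auto simp: FactGroup_def RCOSETS_def)

lemma coset_closed: "y \<in> carrier R \<Longrightarrow> y \<noteq> \<zero> \<Longrightarrow> K #> y \<in> carrier C"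
  by (auto simp: FactGroup_def RCOSETS_def)

lemma coset_self: "y \<in> carrier R \<Longrightarrow> y \<in> K #> y"
  using K_one by (auto simp: r_coset_def intro!: bexI[of _ \<one>])

lemma coset_nonzero: "g \<in> carrier C \<Longrightarrow> y \<in> g \<Longrightarrow> y \<in> carrier R \<and> y \<noteq> \<zero>"
proof -
  assume g: "g \<in> carrier C" and y: "y \<in> g"
  obtain x where x: "x \<in> carrier R" "x \<noteq> \<zero>" "g = K #> x" using coset_cases[OF g] .
  with y obtain k where "k \<in> K" "y = k \<otimes> x" by (auto simp: r_coset_def)
  with x K_nonzero[of k] show ?thesis using integral_iff by simp
qed

lemma coset_eq: "g \<in> carrier C \<Longrightarrow> y \<in> g \<Longrightarrow> g = K #> y"
proof -
  assume g: "g \<in> carrier C" and y: "y \<in> g"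
  obtain x where x: "x \<in> carrier R" "x \<noteq> \<zero>" "g = K #> x" using coset_cases[OF g] .
  then show ?thesis
    using group.repr_independence[OF field_mult_group _ _ K_subgroup, of y x] y by simp
qed

lemma coset_nonempty:
  assumes "g \<in> carrier C" obtains y where "y \<in> g"
  using coset_cases[OF assms] coset_self that by metis

lemma coset_unique: "g \<in> carrier C \<Longrightarrow> h \<in> carrier C \<Longrightarrow> y \<in> g \<Longrightarrow> y \<in> h \<Longrightarrow> g = h"
  using coset_eq by metis

lemma coset_mult:
  assumes "g \<in> carrier C" "h \<in> carrier C" "y \<in> g" "z \<in> h"
  shows "y \<otimes> z \<in> g \<otimes>\<^bsub>C\<^esub> h"
proof -
  have "y \<in> carrier R" "y \<noteq> \<zero>" "z \<in> carrier R" "z \<noteq> \<zero>"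
    using assms coset_nonzero by blast+
  then show ?thesis
    using normal.rcos_sum[OF normal_K, of y z] coset_eq[OF assms(1,3)] coset_eq[OF assms(2,4)]
      coset_self[of "y \<otimes> z"] by (simp add: FactGroup_def)
qed

lemma coset_inv:
  assumes "g \<in> carrier C" "y \<in> g"
  shows "inv y \<in> inv\<^bsub>C\<^esub> g"
proof -
  have y: "y \<in> carrier R" "y \<noteq> \<zero>" using assms coset_nonzero by blast+
  then have "y \<in> Units R" by (simp add: field_Units)
  then show ?thesis
    using normal.inv_FactGroup[OF normal_K assms(1)] normal.rcos_inv[OF normal_K, of y]
      coset_eq[OF assms] y coset_self[of "inv y"] by (simp add: m_inv_mult_of)
qed

text \<open>This form of multiplication in the quotient group replaces computations with cosets by
computations with elements: membership in a coset is all that the relations \<open>r\<close> and \<open>s\<close> test.\<close>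

lemma coset_mult_iff:
  assumes g: "g \<in> carrier C" and h: "h \<in> carrier C" and y: "y \<in> g" and z: "z \<in> carrier R"
  shows "y \<otimes> z \<in> g \<otimes>\<^bsub>C\<^esub> h \<longleftrightarrow> z \<in> h"
proof
  interpret C: group C by (rule group_C)
  have yR: "y \<in> Units R" using coset_nonzero[OF g y] by (simp add: field_Units)
  assume "y \<otimes> z \<in> g \<otimes>\<^bsub>C\<^esub> h"
  then have "inv y \<otimes> (y \<otimes> z) \<in> inv\<^bsub>C\<^esub> g \<otimes>\<^bsub>C\<^esub> (g \<otimes>\<^bsub>C\<^esub> h)"
    by (intro coset_mult[OF C.inv_closed[OF g] C.m_closed[OF g h]] coset_inv[OF g y])
  moreover have "inv\<^bsub>C\<^esub> g \<otimes>\<^bsub>C\<^esub> (g \<otimes>\<^bsub>C\<^esub> h) = h"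
    using C.m_assoc[OF C.inv_closed[OF g] g h] C.l_inv[OF g] C.l_one[OF h] by metis
  moreover have "inv y \<otimes> (y \<otimes> z) = z"
    using yR z m_assoc[of "inv y" y z] Units_closed[OF yR] by simp
  ultimately show "z \<in> h" by simp
qed (use assms coset_mult in blast)

lemma card_coset:
  assumes "g \<in> carrier C" shows "card g = card K"
proof -
  have "g \<in> rcosets\<^bsub>mult_of R\<^esub> K" using assms by (simp add: FactGroup_def)
  then show ?thesis
    using group.card_rcosets_equal[OF field_mult_group] subgroup.subset[OF K_subgroup] by metis
qed

lemma vec_class_eq_iff:
  assumes u: "u \<in> carrier R \<times> carrier R" and v: "v \<in> carrier R \<times> carrier R"
  shows "vec_class R K u = vec_class R K v \<longleftrightarrow> (\<exists>k\<in>K. v = vec_scale R k u)"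
proof
  assume "vec_class R K u = vec_class R K v"
  moreover have "v \<in> vec_class R K v"
    using K_one v vec_scale_one[OF v] unfolding vec_class_def by force
  ultimately show "\<exists>k\<in>K. v = vec_scale R k u" by (auto simp: vec_class_def)
next
  assume "\<exists>k\<in>K. v = vec_scale R k u"
  then obtain k where k: "k \<in> K" "v = vec_scale R k u" by blast
  have kU: "k \<in> Units R" using K_nonzero[OF k(1)] by (simp add: field_Units)
  have "vec_class R K v = (\<lambda>x. vec_scale R x v) ` K" by (auto simp: vec_class_def)
  also have "\<dots> = (\<lambda>x. vec_scale R (x \<otimes> k) u) ` K"
    using K_nonzero k u by (intro image_cong) (simp_all add: vec_scale_scale)
  also have "\<dots> = (\<lambda>x. vec_scale R x u) ` ((\<lambda>x. x \<otimes> k) ` K)" by (simp add: image_image)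
  also have "(\<lambda>x. x \<otimes> k) ` K = K"
  proof (intro equalityI subsetI)
    fix x assume x: "x \<in> K"
    then have "x = (x \<otimes> inv k) \<otimes> k" using kU Units_closed[OF kU] K_nonzero[of x] by (simp add: m_assoc)
    then show "x \<in> (\<lambda>x. x \<otimes> k) ` K" using x k K_inv K_mult by blast
  qed (use k K_mult in auto)
  finally show "vec_class R K u = vec_class R K v" by (auto simp: vec_class_def)
qed

lemma Omega_cases:
  assumes "\<alpha> \<in> Omega R K"
  obtains u where "u \<in> nonzero_vecs R" "\<alpha> = vec_class R K u"
  using assms unfolding Omega_def by blast

lemma vec_class_Omega: "u \<in> nonzero_vecs R \<Longrightarrow> vec_class R K u \<in> Omega R K"
  unfolding Omega_def by blast

lemma finite_Omega: "finite (Omega R K)"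
proof -
  have "Omega R K = vec_class R K ` nonzero_vecs R" by (auto simp: Omega_def)
  then show ?thesis using finite_carrier by (simp add: nonzero_vecs_def)
qed

text \<open>Both relations can be read off from one fixed pair of representatives: the scalar linking the two
vectors, or their determinant, must lie in the given coset.  For the form this includes the
degenerate case, since the class \<open>{\<zero>}\<close> of determinant zero contains no element of a coset.\<close>

lemma r_rel_iff:
  assumes g: "g \<in> carrier C" and u: "u \<in> nonzero_vecs R" and v: "v \<in> nonzero_vecs R"
  shows "(vec_class R K u, vec_class R K v) \<in> r_rel R K g \<longleftrightarrow> (\<exists>c\<in>g. v = vec_scale R c u)"
proof -
  obtain y where y: "y \<in> carrier R" "y \<noteq> \<zero>" "g = K #> y" using coset_cases[OF g] .
  note uv = nonzero_vecs_carrier[OF u] nonzero_vecs_carrier[OF v]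
  have "class_act R g (vec_class R K u) = vec_class R K (vec_scale R y u)"
    unfolding y(3) by (rule class_act_coset[OF K_subgroup y(1) uv(1)])
  moreover have "vec_class R K v = vec_class R K (vec_scale R y u) \<longleftrightarrow> (\<exists>k\<in>K. v = vec_scale R k (vec_scale R y u))"
    using vec_class_eq_iff[of "vec_scale R y u" v] uv y by (metis vec_scale_closed)
  moreover have "\<dots> \<longleftrightarrow> (\<exists>c\<in>g. v = vec_scale R c u)"
    using y uv K_nonzero by (auto simp: r_coset_def vec_scale_scale)
  ultimately show ?thesis using u v vec_class_Omega by (auto simp: r_rel_def)
qed

lemma s_rel_iff:
  assumes g: "g \<in> carrier C" and u: "u \<in> nonzero_vecs R" and v: "v \<in> nonzero_vecs R"
  shows "(vec_class R K u, vec_class R K v) \<in> s_rel R K g \<longleftrightarrow> vec_det R u v \<in> g"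
proof -
  note uv = nonzero_vecs_carrier[OF u] nonzero_vecs_carrier[OF v]
  have "(vec_class R K u, vec_class R K v) \<in> s_rel R K g \<longleftrightarrow> K #> vec_det R u v = g"
    using u v vec_class_Omega class_form_coset[OF K_subgroup uv] by (auto simp: s_rel_def)
  also have "\<dots> \<longleftrightarrow> vec_det R u v \<in> g"
    using coset_eq[OF g] coset_self[of "vec_det R u v"] uv by auto
  finally show ?thesis .
qed


section \<open>Intersection numbers of the relations\<close>

subsection \<open>The relations form a partition\<close>

lemma r_rel_image:
  assumes "g \<in> carrier C" "y \<in> g" "u \<in> nonzero_vecs R"
  shows "(vec_class R K u, \<gamma>) \<in> r_rel R K g \<longleftrightarrow> \<gamma> = vec_class R K (vec_scale R y u)"
proof -
  have y: "y \<in> carrier R" "y \<noteq> \<zero>" using coset_nonzero assms by blast+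
  have "class_act R g (vec_class R K u) = vec_class R K (vec_scale R y u)"
    using class_act_coset[OF K_subgroup y(1) nonzero_vecs_carrier[OF assms(3)]]
      coset_eq[OF assms(1,2)] by simp
  moreover have "vec_class R K (vec_scale R y u) \<in> Omega R K"
    using vec_scale_nonzero[OF y assms(3)] vec_class_Omega by simp
  ultimately show ?thesis using vec_class_Omega[OF assms(3)] by (auto simp: r_rel_def)
qed

lemma r_rel_subset: "r_rel R K g \<subseteq> Omega R K \<times> Omega R K"
  by (auto simp: r_rel_def)

lemma s_rel_subset: "s_rel R K g \<subseteq> Omega R K \<times> Omega R K"
  by (auto simp: s_rel_def)

lemma r_rel_vecs:
  assumes g: "g \<in> carrier C" and ab: "(\<alpha>, \<beta>) \<in> r_rel R K g"
  obtains u c where "u \<in> nonzero_vecs R" "c \<in> g" "vec_scale R c u \<in> nonzero_vecs R"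
    "\<alpha> = vec_class R K u" "\<beta> = vec_class R K (vec_scale R c u)"
proof -
  obtain u where u: "u \<in> nonzero_vecs R" "\<alpha> = vec_class R K u"
    using ab r_rel_subset Omega_cases[of \<alpha>] by blast
  obtain v where v: "v \<in> nonzero_vecs R" "\<beta> = vec_class R K v"
    using ab r_rel_subset Omega_cases[of \<beta>] by blast
  show ?thesis using that[OF u(1) _ _ u(2)] r_rel_iff[OF g u(1) v(1)] ab u v by auto
qed

lemma r_rel_converse:
  assumes g: "g \<in> carrier C"
  shows "(r_rel R K g)\<inverse> = r_rel R K (inv\<^bsub>C\<^esub> g)"
proof -
  interpret C: group C by (rule group_C)
  have *: "(\<beta>, \<alpha>) \<in> r_rel R K (inv\<^bsub>C\<^esub> g)" if g: "g \<in> carrier C" and ab: "(\<alpha>, \<beta>) \<in> r_rel R K g" for \<alpha> \<beta> g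
  proof -
    obtain u c where u: "u \<in> nonzero_vecs R" and c: "c \<in> g"
      and v: "vec_scale R c u \<in> nonzero_vecs R"
      and e: "\<alpha> = vec_class R K u" "\<beta> = vec_class R K (vec_scale R c u)"
      using r_rel_vecs[OF g ab] .
    have cU: "c \<in> Units R" using coset_nonzero[OF g c] by (simp add: field_Units)
    then have "u = vec_scale R (inv c) (vec_scale R c u)"
      using nonzero_vecs_carrier[OF u] Units_closed[OF cU] by (simp add: vec_scale_scale)
    then show ?thesis
      using r_rel_iff[OF C.inv_closed[OF g] v u] coset_inv[OF g c] e by auto
  qed
  show ?thesis using *[of g] *[of "inv\<^bsub>C\<^esub> g"] g by force
qed

lemma r_rel_one: "r_rel R K \<one>\<^bsub>C\<^esub> = Id_on (Omega R K)"
proof -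
  have "(\<alpha>, \<beta>) \<in> r_rel R K \<one>\<^bsub>C\<^esub> \<longleftrightarrow> \<beta> = \<alpha>" if \<alpha>: "\<alpha> \<in> Omega R K" for \<alpha> \<beta>
  proof -
    obtain u where u: "u \<in> nonzero_vecs R" "\<alpha> = vec_class R K u" using Omega_cases[OF \<alpha>] .
    interpret C: group C by (rule group_C)
    have "\<one> \<in> \<one>\<^bsub>C\<^esub>" using K_one by (simp add: FactGroup_def)
    then show ?thesis
      using r_rel_image[OF C.one_closed _ u(1)] nonzero_vecs_carrier[OF u(1)] u(2) by simp
  qed
  moreover have "(\<alpha>, \<beta>) \<in> r_rel R K \<one>\<^bsub>C\<^esub> \<Longrightarrow> \<alpha> \<in> Omega R K" for \<alpha> \<beta>
    using r_rel_subset by blast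
  ultimately have "(\<alpha>, \<beta>) \<in> r_rel R K \<one>\<^bsub>C\<^esub> \<longleftrightarrow> (\<alpha>, \<beta>) \<in> Id_on (Omega R K)" for \<alpha> \<beta>
    unfolding Id_on_iff by blast
  then show ?thesis by (simp only: set_eq_iff split_paired_All) blast
qed

text \<open>Proportional pairs are exactly those with determinant zero; this separates the relations \<open>r\<close> from
the relations \<open>s\<close>.\<close>

lemma ex_r_rel_iff:
  assumes u: "u \<in> nonzero_vecs R" and v: "v \<in> nonzero_vecs R"
  shows "(\<exists>g\<in>carrier C. (vec_class R K u, vec_class R K v) \<in> r_rel R K g) \<longleftrightarrow> vec_det R u v = \<zero>"
proof
  assume "\<exists>g\<in>carrier C. (vec_class R K u, vec_class R K v) \<in> r_rel R K g"
  then obtain g c where g: "g \<in> carrier C" "c \<in> g" "v = vec_scale R c u"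
    using r_rel_iff[OF _ u v] by blast
  then have "c \<in> carrier R" using coset_nonzero by blast
  then show "vec_det R u v = \<zero>"
    using nonzero_vecs_carrier[OF u] by (simp add: g(3) vec_det_scale)
next
  assume "vec_det R u v = \<zero>"
  then obtain c where "c \<in> carrier R" "c \<noteq> \<zero>" "v = vec_scale R c u"
    using vec_det_zeroD[OF u v] by blast
  then show "\<exists>g\<in>carrier C. (vec_class R K u, vec_class R K v) \<in> r_rel R K g"
    using r_rel_iff[OF coset_closed u v, of c] coset_closed[of c] coset_self[of c] by blast
qed

lemma ex_s_rel_iff:
  assumes u: "u \<in> nonzero_vecs R" and v: "v \<in> nonzero_vecs R"
  shows "(\<exists>g\<in>carrier C. (vec_class R K u, vec_class R K v) \<in> s_rel R K g) \<longleftrightarrow> vec_det R u v \<noteq> \<zero>"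
proof -
  have "vec_det R u v \<in> carrier R" using u v nonzero_vecs_carrier by simp
  then show ?thesis
    using s_rel_iff[OF _ u v] coset_nonzero coset_closed[of "vec_det R u v"] coset_self by blast
qed

lemma r_rel_unique:
  assumes g: "g \<in> carrier C" and h: "h \<in> carrier C"
    and p: "p \<in> r_rel R K g" "p \<in> r_rel R K h"
  shows "g = h"
proof -
  obtain \<alpha> \<beta> where ab: "p = (\<alpha>, \<beta>)" by force
  obtain u c where u: "u \<in> nonzero_vecs R" and c: "c \<in> g"
    and v: "vec_scale R c u \<in> nonzero_vecs R"
    and e: "\<alpha> = vec_class R K u" "\<beta> = vec_class R K (vec_scale R c u)"
    using r_rel_vecs[OF g] p ab by blast
  obtain d where "d \<in> h" "vec_scale R c u = vec_scale R d u"
    using r_rel_iff[OF h u v] p ab e by auto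
  moreover have "c \<in> carrier R" "d \<in> carrier R"
    using coset_nonzero g h c calculation by blast+
  ultimately have "c \<in> h" using vec_scale_cancel[OF _ _ u] by metis
  with g h c show ?thesis using coset_unique by blast
qed

lemma s_rel_unique:
  assumes "g \<in> carrier C" "h \<in> carrier C" "p \<in> s_rel R K g" "p \<in> s_rel R K h"
  shows "g = h"
  using assms by (auto simp: s_rel_def)

lemma r_rel_s_rel_disjoint:
  assumes "g \<in> carrier C" "h \<in> carrier C" "p \<in> r_rel R K g"
  shows "p \<notin> s_rel R K h"
proof -
  obtain \<alpha> \<beta> where ab: "p = (\<alpha>, \<beta>)" by force
  obtain u c where "u \<in> nonzero_vecs R" "vec_scale R c u \<in> nonzero_vecs R"
    "\<alpha> = vec_class R K u" "\<beta> = vec_class R K (vec_scale R c u)"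
    using r_rel_vecs[OF assms(1)] assms(3) ab by blast
  then show ?thesis using ex_r_rel_iff ex_s_rel_iff assms ab by blast
qed

lemma r_rel_s_rel_cover:
  assumes "\<alpha> \<in> Omega R K" "\<beta> \<in> Omega R K"
  shows "\<exists>g\<in>carrier C. (\<alpha>, \<beta>) \<in> r_rel R K g \<or> (\<alpha>, \<beta>) \<in> s_rel R K g"
proof -
  obtain u v where "u \<in> nonzero_vecs R" "\<alpha> = vec_class R K u"
    "v \<in> nonzero_vecs R" "\<beta> = vec_class R K v"
    using Omega_cases assms by metis
  then show ?thesis using ex_r_rel_iff[of u v] ex_s_rel_iff[of u v] by blast
qed

lemma nonzero_vec_exists: "(\<one>, \<zero>) \<in> nonzero_vecs R"
  by (simp add: nonzero_vecs_def)

lemma r_rel_nonempty: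
  assumes g: "g \<in> carrier C" shows "r_rel R K g \<noteq> {}"
proof -
  obtain y where "y \<in> g" using coset_nonempty[OF g] .
  with r_rel_image[OF g _ nonzero_vec_exists] show ?thesis by blast
qed

lemma s_rel_nonempty:
  assumes g: "g \<in> carrier C" shows "s_rel R K g \<noteq> {}"
proof -
  obtain y where y: "y \<in> g" using coset_nonempty[OF g] .
  have yR: "y \<in> carrier R" "y \<noteq> \<zero>" using coset_nonzero[OF g y] by auto
  have "vec_det R (\<one>, \<zero>) (\<zero>, y) = y" using yR by (simp add: vec_det_def a_minus_def)
  moreover have "(\<zero>, y) \<in> nonzero_vecs R" using yR by (simp add: nonzero_vecs_def)
  ultimately show ?thesis using s_rel_iff[OF g nonzero_vec_exists] y by fastforce
qed

subsection \<open>Products with a relation of scalar type\<close>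

text \<open>A relation \<open>r\<close> is the graph of a permutation, so a product with it is again a single relation and
every intersection number is 0 or 1.\<close>

lemma card_r_r:
  assumes g: "g \<in> carrier C" and h: "h \<in> carrier C" and "\<alpha> \<in> Omega R K" "\<beta> \<in> Omega R K"
  shows "card {\<gamma>. (\<alpha>, \<gamma>) \<in> r_rel R K g \<and> (\<gamma>, \<beta>) \<in> r_rel R K h} =
    (if (\<alpha>, \<beta>) \<in> r_rel R K (g \<otimes>\<^bsub>C\<^esub> h) then 1 else 0)"
proof -
  interpret C: group C by (rule group_C)
  obtain u where u: "u \<in> nonzero_vecs R" "\<alpha> = vec_class R K u" using Omega_cases assms(3) .
  obtain v where v: "v \<in> nonzero_vecs R" "\<beta> = vec_class R K v" using Omega_cases assms(4) .
  obtain y where y: "y \<in> g" using coset_nonempty[OF g] .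
  have yR: "y \<in> carrier R" "y \<noteq> \<zero>" using coset_nonzero[OF g y] by auto
  have yU: "y \<in> Units R" using yR by (simp add: field_Units)
  let ?w = "vec_scale R y u"
  have w: "?w \<in> nonzero_vecs R" using vec_scale_nonzero yR u by simp
  have "(\<exists>c\<in>h. v = vec_scale R c ?w) \<longleftrightarrow> (\<exists>d\<in>g \<otimes>\<^bsub>C\<^esub> h. v = vec_scale R d u)"
  proof
    assume "\<exists>c\<in>h. v = vec_scale R c ?w"
    then obtain c where c: "c \<in> h" "v = vec_scale R c ?w" by blast
    then have "v = vec_scale R (y \<otimes> c) u"
      using coset_nonzero[OF h c(1)] yR nonzero_vecs_carrier[OF u(1)]
      by (simp add: vec_scale_scale m_comm)
    with coset_mult[OF g h y c(1)] show "\<exists>d\<in>g \<otimes>\<^bsub>C\<^esub> h. v = vec_scale R d u" by blast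
  next
    assume "\<exists>d\<in>g \<otimes>\<^bsub>C\<^esub> h. v = vec_scale R d u"
    then obtain d where d: "d \<in> g \<otimes>\<^bsub>C\<^esub> h" "v = vec_scale R d u" by blast
    have dR: "d \<in> carrier R" using coset_nonzero[OF C.m_closed[OF g h] d(1)] by simp
    have e: "d = y \<otimes> (inv y \<otimes> d)" using dR yR yU by (simp add: m_assoc[symmetric])
    have "inv y \<otimes> d \<in> h" using coset_mult_iff[OF g h y, of "inv y \<otimes> d"] d(1) e dR yU by simp
    moreover have "v = vec_scale R (inv y \<otimes> d) ?w"
      using d(2) e dR yU yR nonzero_vecs_carrier[OF u(1)]
      by (simp add: vec_scale_scale m_comm)
    ultimately show "\<exists>c\<in>h. v = vec_scale R c ?w" by blast
  qed
  then have "(vec_class R K ?w, \<beta>) \<in> r_rel R K h \<longleftrightarrow> (\<alpha>, \<beta>) \<in> r_rel R K (g \<otimes>\<^bsub>C\<^esub> h)"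
    using r_rel_iff[OF h w v(1)] r_rel_iff[OF C.m_closed[OF g h] u(1) v(1)] u v by simp
  then have "{\<gamma>. (\<alpha>, \<gamma>) \<in> r_rel R K g \<and> (\<gamma>, \<beta>) \<in> r_rel R K h} =
    (if (\<alpha>, \<beta>) \<in> r_rel R K (g \<otimes>\<^bsub>C\<^esub> h) then {vec_class R K ?w} else {})"
    unfolding u(2) r_rel_image[OF g y u(1)] by auto
  then show ?thesis by simp
qed

text \<open>The only candidate for \<open>\<gamma>\<close> is the image of \<open>\<alpha>\<close> under \<open>g\<close>.  Its form with \<open>\<beta>\<close> is \<open>g\<close> times that of \<open>\<alpha>\<close>,
whence the inverse of \<open>g\<close>.\<close>

lemma card_r_s:
  assumes g: "g \<in> carrier C" and h: "h \<in> carrier C" and "\<alpha> \<in> Omega R K" "\<beta> \<in> Omega R K"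
  shows "card {\<gamma>. (\<alpha>, \<gamma>) \<in> r_rel R K g \<and> (\<gamma>, \<beta>) \<in> s_rel R K h} =
    (if (\<alpha>, \<beta>) \<in> s_rel R K (inv\<^bsub>C\<^esub> g \<otimes>\<^bsub>C\<^esub> h) then 1 else 0)"
proof -
  interpret C: group C by (rule group_C)
  obtain u where u: "u \<in> nonzero_vecs R" "\<alpha> = vec_class R K u" using Omega_cases assms(3) .
  obtain v where v: "v \<in> nonzero_vecs R" "\<beta> = vec_class R K v" using Omega_cases assms(4) .
  note uv = nonzero_vecs_carrier[OF u(1)] nonzero_vecs_carrier[OF v(1)]
  obtain y where y: "y \<in> g" using coset_nonempty[OF g] .
  have yR: "y \<in> carrier R" "y \<noteq> \<zero>" using coset_nonzero[OF g y] by auto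
  let ?w = "vec_scale R y u"
  have w: "?w \<in> nonzero_vecs R" using vec_scale_nonzero yR u by simp
  have h': "inv\<^bsub>C\<^esub> g \<otimes>\<^bsub>C\<^esub> h \<in> carrier C" using C.m_closed[OF C.inv_closed[OF g] h] .
  have "g \<otimes>\<^bsub>C\<^esub> (inv\<^bsub>C\<^esub> g \<otimes>\<^bsub>C\<^esub> h) = h"
    using C.m_assoc[OF g C.inv_closed[OF g] h] C.r_inv[OF g] C.l_one[OF h] by metis
  then have "vec_det R ?w v \<in> h \<longleftrightarrow> vec_det R u v \<in> inv\<^bsub>C\<^esub> g \<otimes>\<^bsub>C\<^esub> h"
    using coset_mult_iff[OF g h' y, of "vec_det R u v"] uv yR by (simp add: vec_det_scale)
  then have "(vec_class R K ?w, \<beta>) \<in> s_rel R K h \<longleftrightarrow> (\<alpha>, \<beta>) \<in> s_rel R K (inv\<^bsub>C\<^esub> g \<otimes>\<^bsub>C\<^esub> h)"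
    using s_rel_iff[OF h w v(1)] s_rel_iff[OF h' u(1) v(1)] u v by simp
  then have "{\<gamma>. (\<alpha>, \<gamma>) \<in> r_rel R K g \<and> (\<gamma>, \<beta>) \<in> s_rel R K h} =
    (if (\<alpha>, \<beta>) \<in> s_rel R K (inv\<^bsub>C\<^esub> g \<otimes>\<^bsub>C\<^esub> h) then {vec_class R K ?w} else {})"
    unfolding u(2) r_rel_image[OF g y u(1)] by auto
  then show ?thesis by simp
qed

end

subsection \<open>Symmetry of the form and products of two relations of determinant type\<close>

text \<open>The determinant is alternating, so the form on classes is symmetric exactly because \<open>- 1\<close> lies in
\<open>K\<close>.\<close>

locale symmetric_plane_classes = plane_classes +
  assumes minus_one_K: "\<ominus> \<one> \<in> K"
begin

lemma coset_minus_iff: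
  assumes g: "g \<in> carrier C" and y: "y \<in> carrier R"
  shows "\<ominus> y \<in> g \<longleftrightarrow> y \<in> g"
proof -
  interpret C: group C by (rule group_C)
  have "\<ominus> \<one> \<in> \<one>\<^bsub>C\<^esub>" using minus_one_K by (simp add: FactGroup_def)
  then show ?thesis
    using coset_mult_iff[OF C.one_closed g _ y, of "\<ominus> \<one>"] C.l_one[OF g] y by (simp add: l_minus)
qed

lemma s_rel_sym:
  assumes g: "g \<in> carrier C"
  shows "(s_rel R K g)\<inverse> = s_rel R K g"
proof -
  have "(\<beta>, \<alpha>) \<in> s_rel R K g" if ab: "(\<alpha>, \<beta>) \<in> s_rel R K g" for \<alpha> \<beta>
  proof -
    have "\<alpha> \<in> Omega R K" "\<beta> \<in> Omega R K" using ab s_rel_subset by blast+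
    then obtain u v where u: "u \<in> nonzero_vecs R" "\<alpha> = vec_class R K u"
      and v: "v \<in> nonzero_vecs R" "\<beta> = vec_class R K v"
      by (elim Omega_cases)
    then show ?thesis
      using ab s_rel_iff[OF g u(1) v(1)] s_rel_iff[OF g v(1) u(1)]
        vec_det_swap[of u v] coset_minus_iff[OF g, of "vec_det R u v"] nonzero_vecs_carrier by simp
  qed
  then show ?thesis by auto
qed

text \<open>Transposing the product reduces this to \<open>card_r_s\<close>, because the relations \<open>s\<close> are symmetric.\<close>

lemma card_s_r:
  assumes g: "g \<in> carrier C" and h: "h \<in> carrier C" and \<alpha>: "\<alpha> \<in> Omega R K" and \<beta>: "\<beta> \<in> Omega R K"
  shows "card {\<gamma>. (\<alpha>, \<gamma>) \<in> s_rel R K g \<and> (\<gamma>, \<beta>) \<in> r_rel R K h} =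
    (if (\<alpha>, \<beta>) \<in> s_rel R K (h \<otimes>\<^bsub>C\<^esub> g) then 1 else 0)"
proof -
  interpret C: group C by (rule group_C)
  have "{\<gamma>. (\<alpha>, \<gamma>) \<in> s_rel R K g \<and> (\<gamma>, \<beta>) \<in> r_rel R K h} =
      {\<gamma>. (\<beta>, \<gamma>) \<in> r_rel R K (inv\<^bsub>C\<^esub> h) \<and> (\<gamma>, \<alpha>) \<in> s_rel R K g}"
    unfolding r_rel_converse[OF h, symmetric] using s_rel_sym[OF g] by auto
  moreover have "(\<beta>, \<alpha>) \<in> s_rel R K (h \<otimes>\<^bsub>C\<^esub> g) \<longleftrightarrow> (\<alpha>, \<beta>) \<in> s_rel R K (h \<otimes>\<^bsub>C\<^esub> g)"
    using s_rel_sym[OF C.m_closed[OF h g]] by blast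
  ultimately show ?thesis
    using card_r_s[OF C.inv_closed[OF h] g \<beta> \<alpha>] unfolding C.inv_inv[OF h] by simp
qed

text \<open>Let \<open>\<alpha>\<close> and \<open>\<beta>\<close> be the classes of \<open>u\<close> and \<open>v\<close>, let \<open>y \<in> g\<close> and let \<open>w\<close> satisfy \<open>det(u, w) = 1\<close>.
A class \<open>\<gamma>\<close> with form value \<open>g\<close> at \<open>\<alpha>\<close> has exactly one representative \<open>x\<close> with \<open>det(u, x) = y\<close>, and these
representatives form the affine line of the vectors \<open>y w + z u\<close>, where \<open>z\<close> runs over the field.  So
one counts the \<open>z\<close> for which the affine function \<open>z \<mapsto> y det(w, v) + z det(u, v)\<close> takes a value in
\<open>h\<close>.  If \<open>det(u, v)\<close> is nonzero this function is a bijection and the number is \<open>card h = card K\<close>;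
otherwise it is constant and either all \<open>z\<close> or none of them count.\<close>

lemma card_s_s:
  assumes g: "g \<in> carrier C" and h: "h \<in> carrier C" and \<alpha>: "\<alpha> \<in> Omega R K" and \<beta>: "\<beta> \<in> Omega R K"
  shows "card {\<gamma>. (\<alpha>, \<gamma>) \<in> s_rel R K g \<and> (\<gamma>, \<beta>) \<in> s_rel R K h} =
    (if (\<alpha>, \<beta>) \<in> r_rel R K (inv\<^bsub>C\<^esub> g \<otimes>\<^bsub>C\<^esub> h) then order R else 0) +
    (if \<exists>t\<in>carrier C. (\<alpha>, \<beta>) \<in> s_rel R K t then card K else 0)"
proof -
  interpret C: group C by (rule group_C)
  obtain u where u: "u \<in> nonzero_vecs R" "\<alpha> = vec_class R K u" using Omega_cases \<alpha> .
  obtain v where v: "v \<in> nonzero_vecs R" "\<beta> = vec_class R K v" using Omega_cases \<beta> .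
  note uv = nonzero_vecs_carrier[OF u(1)] nonzero_vecs_carrier[OF v(1)]
  obtain y where y: "y \<in> g" using coset_nonempty[OF g] .
  have yR: "y \<in> carrier R" "y \<noteq> \<zero>" using coset_nonzero[OF g y] by auto
  obtain w where w: "w \<in> carrier R \<times> carrier R" "vec_det R u w = \<one>"
    using ex_vec_det_one[OF u(1)] .
  define p where "p z = vec_add R (vec_scale R y w) (vec_scale R z u)" for z
  have p: "p z \<in> carrier R \<times> carrier R" "vec_det R u (p z) = y" "vec_det R (p z) w = z"
    "vec_det R (p z) v = y \<otimes> vec_det R w v \<oplus> z \<otimes> vec_det R u v" if "z \<in> carrier R" for z
    using that uv w yR by (simp_all add: p_def vec_det_add vec_det_scale)
  have p_nz: "p z \<in> nonzero_vecs R" if "z \<in> carrier R" for z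
  proof -
    have "p z \<noteq> (\<zero>, \<zero>)" using p(2)[OF that] yR uv by (auto simp: vec_det_def a_minus_def)
    with p(1)[OF that] show ?thesis by (simp add: nonzero_vecs_def)
  qed
  let ?Z = "{z \<in> carrier R. y \<otimes> vec_det R w v \<oplus> z \<otimes> vec_det R u v \<in> h}"
  have "inj_on (\<lambda>z. vec_class R K (p z)) (carrier R)"
  proof (rule inj_onI)
    fix z z' assume z: "z \<in> carrier R" "z' \<in> carrier R" and eq: "vec_class R K (p z) = vec_class R K (p z')"
    then obtain k where k: "k \<in> K" "p z' = vec_scale R k (p z)"
      using vec_class_eq_iff p(1) by blast
    have kR: "k \<in> carrier R" using K_nonzero k by blast
    \<comment> \<open>The normalisation \<open>det(u, x) = y\<close> leaves no freedom of scaling.\<close>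
    have "y = k \<otimes> y" using p(2) z k(2) p(1) uv kR by (metis vec_det_scale(2))
    then have "k = \<one>" using yR kR by (metis m_rcancel l_one one_closed)
    then have "p z = p z'" using k(2) p(1)[OF z(1)] by simp
    then show "z = z'" using p(3) z by metis
  qed
  then have inj: "inj_on (\<lambda>z. vec_class R K (p z)) ?Z" by (rule inj_on_subset) auto
  have "{\<gamma>. (\<alpha>, \<gamma>) \<in> s_rel R K g \<and> (\<gamma>, \<beta>) \<in> s_rel R K h} = (\<lambda>z. vec_class R K (p z)) ` ?Z"
  proof (intro equalityI subsetI)
    fix \<gamma> assume "\<gamma> \<in> {\<gamma>. (\<alpha>, \<gamma>) \<in> s_rel R K g \<and> (\<gamma>, \<beta>) \<in> s_rel R K h}"
    then have \<gamma>: "(\<alpha>, \<gamma>) \<in> s_rel R K g" "(\<gamma>, \<beta>) \<in> s_rel R K h" by auto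
    obtain x where x: "x \<in> nonzero_vecs R" "\<gamma> = vec_class R K x"
      using \<gamma>(1) s_rel_subset Omega_cases[of \<gamma>] by blast
    have xR: "x \<in> carrier R \<times> carrier R" using nonzero_vecs_carrier x by blast
    have "vec_det R u x \<in> g" using s_rel_iff[OF g u(1) x(1)] \<gamma>(1) u x by simp
    then have "y \<in> K #> vec_det R u x" using coset_eq[OF g] y by blast
    then obtain k where k: "k \<in> K" "y = k \<otimes> vec_det R u x" by (auto simp: r_coset_def)
    have kR: "k \<in> carrier R" "k \<noteq> \<zero>" using K_nonzero k by auto
    let ?x = "vec_scale R k x"
    have x': "?x \<in> nonzero_vecs R" using vec_scale_nonzero kR x by simp
    note x'R = nonzero_vecs_carrier[OF x']
    have \<gamma>': "\<gamma> = vec_class R K ?x" using vec_class_eq_iff[OF xR x'R] k x by blast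
    let ?z = "vec_det R ?x w"
    have "vec_det R u ?x = y" using k kR uv xR by (simp add: vec_det_scale)
    then have px: "?x = p ?z" using vec_expansion[OF uv(1) w(1) x'R w(2)] by (simp add: p_def)
    have z: "?z \<in> carrier R" using x'R w by simp
    have "vec_det R ?x v \<in> h" using s_rel_iff[OF h x' v(1)] \<gamma>(2) \<gamma>' v by simp
    then have "?z \<in> ?Z" using p(4)[OF z] px z by simp
    then show "\<gamma> \<in> (\<lambda>z. vec_class R K (p z)) ` ?Z"
      unfolding \<gamma>' by (rule image_eqI[OF arg_cong[OF px]])
  next
    fix \<gamma> assume "\<gamma> \<in> (\<lambda>z. vec_class R K (p z)) ` ?Z"
    then obtain z where z: "z \<in> ?Z" "\<gamma> = vec_class R K (p z)" by blast
    then show "\<gamma> \<in> {\<gamma>. (\<alpha>, \<gamma>) \<in> s_rel R K g \<and> (\<gamma>, \<beta>) \<in> s_rel R K h}"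
      using s_rel_iff[OF g u(1) p_nz[of z]] s_rel_iff[OF h p_nz[of z] v(1)] p[of z] y u v by simp
  qed
  then have card: "card {\<gamma>. (\<alpha>, \<gamma>) \<in> s_rel R K g \<and> (\<gamma>, \<beta>) \<in> s_rel R K h} = card ?Z"
    using card_image[OF inj] by simp
  have gh: "inv\<^bsub>C\<^esub> g \<otimes>\<^bsub>C\<^esub> h \<in> carrier C" using C.m_closed[OF C.inv_closed[OF g] h] .
  have g_gh: "g \<otimes>\<^bsub>C\<^esub> (inv\<^bsub>C\<^esub> g \<otimes>\<^bsub>C\<^esub> h) = h"
    using C.m_assoc[OF g C.inv_closed[OF g] h] C.r_inv[OF g] C.l_one[OF h] by metis
  show ?thesis
  proof (cases "vec_det R u v = \<zero>")
    case True
    then obtain c where c: "c \<in> carrier R" "c \<noteq> \<zero>" "v = vec_scale R c u"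
      using vec_det_zeroD[OF u(1) v(1)] by blast
    \<comment> \<open>The constant value \<open>- y c\<close> may be replaced by \<open>y c\<close>, since \<open>- 1\<close> is in \<open>K\<close>.\<close>
    have wv: "vec_det R w v = \<ominus> c"
      using c uv w vec_det_swap[OF uv(1) w(1)] by (simp add: vec_det_scale r_minus)
    have "y \<otimes> vec_det R w v \<oplus> z \<otimes> vec_det R u v \<in> h \<longleftrightarrow> c \<in> inv\<^bsub>C\<^esub> g \<otimes>\<^bsub>C\<^esub> h"
      if "z \<in> carrier R" for z
      using that True wv c yR coset_minus_iff[OF h, of "y \<otimes> c"] coset_mult_iff[OF g gh y c(1)] g_gh
      by (simp add: r_minus)
    then have "?Z = (if c \<in> inv\<^bsub>C\<^esub> g \<otimes>\<^bsub>C\<^esub> h then carrier R else {})" by auto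
    moreover have "(\<alpha>, \<beta>) \<in> r_rel R K (inv\<^bsub>C\<^esub> g \<otimes>\<^bsub>C\<^esub> h) \<longleftrightarrow> c \<in> inv\<^bsub>C\<^esub> g \<otimes>\<^bsub>C\<^esub> h"
      using r_rel_iff[OF gh u(1) v(1)] u(2) v(2) c vec_scale_cancel[OF _ _ u(1)] coset_nonzero[OF gh]
      by metis
    moreover have "\<not> (\<exists>t\<in>carrier C. (\<alpha>, \<beta>) \<in> s_rel R K t)"
      using ex_s_rel_iff[OF u(1) v(1)] u v True by simp
    ultimately show ?thesis using card by (simp add: order_def)
  next
    case False
    define D where "D = vec_det R u v"
    have DR: "D \<in> carrier R" using uv by (simp add: D_def)
    have DU: "D \<in> Units R" using False DR by (simp add: field_Units D_def)
    define a where "a = y \<otimes> vec_det R w v"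
    have aR: "a \<in> carrier R" using yR w uv by (simp add: a_def)
    have Z: "?Z = (\<lambda>t. (t \<ominus> a) \<otimes> inv D) ` h"
    proof (intro equalityI subsetI)
      fix z assume "z \<in> ?Z"
      then have z: "z \<in> carrier R" "a \<oplus> z \<otimes> D \<in> h" by (auto simp: a_def D_def)
      have "z \<otimes> D \<otimes> inv D = z" using z DU DR by (simp add: m_assoc)
      moreover have "a \<oplus> z \<otimes> D \<ominus> a = z \<otimes> D" using z(1) DR aR by algebra
      ultimately show "z \<in> (\<lambda>t. (t \<ominus> a) \<otimes> inv D) ` h" using z(2) by force
    next
      fix z assume "z \<in> (\<lambda>t. (t \<ominus> a) \<otimes> inv D) ` h"
      then obtain t where t: "t \<in> h" "z = (t \<ominus> a) \<otimes> inv D" by blast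
      have tR: "t \<in> carrier R" using coset_nonzero[OF h t(1)] by simp
      have "z \<otimes> D = t \<ominus> a" using t(2) tR aR DU DR by (simp add: m_assoc)
      moreover have "a \<oplus> (t \<ominus> a) = t" using tR aR by algebra
      ultimately show "z \<in> ?Z" using t tR aR DU DR by (simp add: a_def D_def)
    qed
    have "inj_on (\<lambda>t. (t \<ominus> a) \<otimes> inv D) h"
    proof (rule inj_onI)
      fix s t assume st: "s \<in> h" "t \<in> h" and eq: "(s \<ominus> a) \<otimes> inv D = (t \<ominus> a) \<otimes> inv D"
      have R: "s \<in> carrier R" "t \<in> carrier R" using coset_nonzero[OF h] st by auto
      have "s \<ominus> a = (s \<ominus> a) \<otimes> inv D \<otimes> D" using R aR DU DR by (simp add: m_assoc)
      also have "\<dots> = t \<ominus> a" using R aR DU DR by (simp add: eq m_assoc)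
      finally show "s = t" using R aR by (simp add: a_minus_def)
    qed
    then have "card ?Z = card K" using Z card_image card_coset[OF h] by metis
    moreover have "(\<alpha>, \<beta>) \<notin> r_rel R K (inv\<^bsub>C\<^esub> g \<otimes>\<^bsub>C\<^esub> h)"
      using ex_r_rel_iff[OF u(1) v(1)] u v False gh by blast
    moreover have "\<exists>t\<in>carrier C. (\<alpha>, \<beta>) \<in> s_rel R K t"
      using ex_s_rel_iff[OF u(1) v(1)] u v False by simp
    ultimately show ?thesis using card by simp
  qed
qed

end

section \<open>Minus one in a subgroup of the multiplicative group\<close>

text \<open>The evenness of the product is used in two ways.  If \<open>K\<close> has even order, then \<open>K\<close> contains all
solutions of \<open>x ^ card K = 1\<close>, of which there are at most \<open>card K\<close>, and \<open>- 1\<close> is one of them.  If the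
field has even order, then \<open>- 1 = 1\<close>, because the multiplicative group has odd order.\<close>

lemma (in field) minus_one_in_subgroup:
  assumes fin: "finite (carrier R)" and K: "subgroup K (mult_of R)"
    and even: "even (order R * card K)"
  shows "\<ominus> \<one> \<in> K"
proof (cases "even (card K)")
  case True
  interpret M: group "mult_of R" by (rule field_mult_group)
  have finM: "finite (carrier (mult_of R))" using fin by simp
  have finK: "finite K" using finite_subset[OF subgroup.subset[OF K] finM] .
  have "\<one> \<in> K" using subgroup.one_closed[OF K] by simp
  then have pos: "card K \<noteq> 0" using finK by auto
  interpret KG: group "mult_of R\<lparr>carrier := K\<rparr>" using M.subgroup_imp_group[OF K] .
  have "K \<subseteq> {x \<in> carrier R. x [^] card K = \<one>}"
  proof
    fix x assume x: "x \<in> K"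
    then have "x [^]\<^bsub>mult_of R\<lparr>carrier := K\<rparr>\<^esub> card K = \<one>"
      using KG.pow_order_eq_1[of x] by (simp add: order_def)
    then show "x \<in> {x \<in> carrier R. x [^] card K = \<one>}"
      using x subgroup.subset[OF K] M.nat_pow_consistent[of x "card K"] by (auto simp: nat_pow_mult_of)
  qed
  then have K_eq: "K = {x \<in> carrier R. x [^] card K = \<one>}"
    using fin by (intro card_seteq num_roots_le_deg[OF fin pos]) auto
  have "(\<ominus> \<one>) [^] card K = \<one>"
  proof -
    obtain m where m: "card K = 2 * m" using True by blast
    have "(\<ominus> \<one>) [^] (2::nat) = \<one>" by (simp add: numeral_2_eq_2 l_minus)
    then show ?thesis unfolding m by (metis nat_pow_pow nat_pow_one a_inv_closed one_closed)
  qed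
  then have "\<ominus> \<one> \<in> {x \<in> carrier R. x [^] card K = \<one>}" by simp
  with K_eq show ?thesis by (rule ssubst)
next
  case False
  interpret M: group "mult_of R" by (rule field_mult_group)
  have m1: "\<ominus> \<one> \<in> carrier (mult_of R)" by simp
  have "order R \<noteq> 0" using fin by (auto simp: order_def)
  then have "odd (order R - 1)" using False even by auto
  then obtain m where m: "order R - 1 = 2 * m + 1" by (rule oddE)
  have sq: "(\<ominus> \<one>) [^] (2::nat) = \<one>" by (simp add: numeral_2_eq_2 l_minus)
  have "(\<ominus> \<one>) [^] (order R - 1) = \<one>"
    using M.pow_order_eq_1[OF m1] order_mult_of[OF fin] by (simp add: nat_pow_mult_of)
  moreover have "(\<ominus> \<one>) [^] (2 * m) = \<one>"
    using sq by (metis nat_pow_pow nat_pow_one a_inv_closed one_closed)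
  ultimately have "\<ominus> \<one> = \<one>" unfolding m by simp
  then show ?thesis using subgroup.one_closed[OF K] by simp
qed

section \<open>Generalized dihedral groups\<close>

text \<open>The image of \<open>C\<close> consists of the rotations and its coset by \<open>b\<close> of the reflections.  The
assumption \<open>cover\<close> says that the rotations have index at most two.\<close>

locale generalized_dihedral = G: group G + C: group C for G (structure) and C +
  fixes \<iota> b
  assumes mon: "\<iota> \<in> mon C G"
    and b_closed: "b \<in> carrier G"
    and b_square: "b \<otimes> b = \<one>"
    and b_notin: "b \<notin> \<iota> ` carrier C"
    and cover: "x \<in> carrier G \<Longrightarrow> x \<in> \<iota> ` carrier C \<or> b \<otimes> x \<in> \<iota> ` carrier C"
    and conj: "g \<in> carrier C \<Longrightarrow> b \<otimes> \<iota> g \<otimes> b = \<iota> (inv\<^bsub>C\<^esub> g)"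
begin

lemma \<iota>_closed: "g \<in> carrier C \<Longrightarrow> \<iota> g \<in> carrier G"
  using mon by (auto simp: mon_def hom_def)

lemma \<iota>_mult: "g \<in> carrier C \<Longrightarrow> h \<in> carrier C \<Longrightarrow> \<iota> (g \<otimes>\<^bsub>C\<^esub> h) = \<iota> g \<otimes> \<iota> h"
  using mon by (simp add: mon_def hom_mult)

lemma inj_\<iota>: "inj_on \<iota> (carrier C)"
  using mon by (simp add: mon_def)

lemma group_hom_\<iota>: "group_hom C G \<iota>"
  using mon by unfold_locales (simp add: mon_def)

lemma b_cancel: "x \<in> carrier G \<Longrightarrow> b \<otimes> (b \<otimes> x) = x"
  using b_closed by (simp add: G.m_assoc[symmetric] b_square)

lemma elem_cases:
  assumes "x \<in> carrier G"
  obtains (rotation) g where "g \<in> carrier C" "x = \<iota> g"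
  | (reflection) g where "g \<in> carrier C" "x = b \<otimes> \<iota> g"
proof -
  consider "x \<in> \<iota> ` carrier C" | "b \<otimes> x \<in> \<iota> ` carrier C" using cover[OF assms] by blast
  then show ?thesis
  proof cases
    case 2
    then obtain g where "g \<in> carrier C" "b \<otimes> x = \<iota> g" by blast
    then show ?thesis using reflection b_cancel[OF assms] by metis
  qed (use rotation in blast)
qed

lemma reflection_notin: "g \<in> carrier C \<Longrightarrow> b \<otimes> \<iota> g \<notin> \<iota> ` carrier C"
proof
  assume g: "g \<in> carrier C" and "b \<otimes> \<iota> g \<in> \<iota> ` carrier C"
  then obtain h where h: "h \<in> carrier C" "b \<otimes> \<iota> g = \<iota> h" by blast
  interpret hom: group_hom C G \<iota> by (rule group_hom_\<iota>)
  have "b = \<iota> h \<otimes> inv \<iota> g"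
    using h g b_closed by (metis G.inv_solve_right \<iota>_closed)
  also have "\<dots> = \<iota> (h \<otimes>\<^bsub>C\<^esub> inv\<^bsub>C\<^esub> g)" using g h by simp
  finally show False using b_notin g h(1) by blast
qed

lemma swap: "g \<in> carrier C \<Longrightarrow> \<iota> g \<otimes> b = b \<otimes> \<iota> (inv\<^bsub>C\<^esub> g)"
  using conj[of g] b_cancel[of "\<iota> g \<otimes> b"] b_closed \<iota>_closed[of g] by (simp add: G.m_assoc)

lemma rotation_reflection:
  assumes "g \<in> carrier C" "h \<in> carrier C"
  shows "\<iota> g \<otimes> (b \<otimes> \<iota> h) = b \<otimes> \<iota> (inv\<^bsub>C\<^esub> g \<otimes>\<^bsub>C\<^esub> h)"
proof -
  have "\<iota> g \<otimes> (b \<otimes> \<iota> h) = (\<iota> g \<otimes> b) \<otimes> \<iota> h"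
    using assms \<iota>_closed b_closed by (simp add: G.m_assoc)
  then show ?thesis using assms \<iota>_closed b_closed by (simp add: swap \<iota>_mult G.m_assoc)
qed

lemma reflection_rotation:
  "g \<in> carrier C \<Longrightarrow> h \<in> carrier C \<Longrightarrow> (b \<otimes> \<iota> g) \<otimes> \<iota> h = b \<otimes> \<iota> (g \<otimes>\<^bsub>C\<^esub> h)"
  using \<iota>_closed b_closed by (simp add: \<iota>_mult G.m_assoc)

lemma reflection_reflection:
  assumes "g \<in> carrier C" "h \<in> carrier C"
  shows "(b \<otimes> \<iota> g) \<otimes> (b \<otimes> \<iota> h) = \<iota> (inv\<^bsub>C\<^esub> g \<otimes>\<^bsub>C\<^esub> h)"
proof -
  have "(b \<otimes> \<iota> g) \<otimes> (b \<otimes> \<iota> h) = b \<otimes> (\<iota> g \<otimes> (b \<otimes> \<iota> h))"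
    using assms \<iota>_closed b_closed by (simp add: G.m_assoc)
  also have "\<dots> = \<iota> (inv\<^bsub>C\<^esub> g \<otimes>\<^bsub>C\<^esub> h)"
    unfolding rotation_reflection[OF assms] using assms by (intro b_cancel \<iota>_closed) simp
  finally show ?thesis .
qed

lemma inv_rotation: "g \<in> carrier C \<Longrightarrow> inv (\<iota> g) = \<iota> (inv\<^bsub>C\<^esub> g)"
  using group_hom.hom_inv[OF group_hom_\<iota>] by simp

lemma inv_reflection: "g \<in> carrier C \<Longrightarrow> inv (b \<otimes> \<iota> g) = b \<otimes> \<iota> g"
  using reflection_reflection[of g g] group_hom.hom_one[OF group_hom_\<iota>] b_closed \<iota>_closed[of g]
  by (intro G.inv_equality) simp_all

end

section \<open>Relations labelled by the generalized dihedral group\<close>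

locale dihedral_plane =
  symmetric_plane_classes R K +
  dih: generalized_dihedral G "mult_of R Mod K" \<iota> b
  for R (structure) and K and G and \<iota> and b
begin

text \<open>Rotations label the relations \<open>r\<close> and reflections the relations \<open>s\<close>; since \<open>b\<close> is an involution, the
element of \<open>C\<close> that belongs to a reflection \<open>x\<close> is the preimage of \<open>b x\<close>.\<close>

definition colour_rel where
  "colour_rel x =
    (if x \<in> \<iota> ` carrier C then r_rel R K (the_inv_into (carrier C) \<iota> x)
     else s_rel R K (the_inv_into (carrier C) \<iota> (b \<otimes>\<^bsub>G\<^esub> x)))"

lemma colour_rel_rotation [simp]: "g \<in> carrier C \<Longrightarrow> colour_rel (\<iota> g) = r_rel R K g"
  by (simp add: colour_rel_def the_inv_into_f_f[OF dih.inj_\<iota>])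

lemma colour_rel_reflection [simp]:
  "g \<in> carrier C \<Longrightarrow> colour_rel (b \<otimes>\<^bsub>G\<^esub> \<iota> g) = s_rel R K g"
  using dih.b_cancel[OF dih.\<iota>_closed, of g] dih.reflection_notin[of g]
  by (simp add: colour_rel_def the_inv_into_f_f[OF dih.inj_\<iota>])

lemma colour_rel_subset: "colour_rel x \<subseteq> Omega R K \<times> Omega R K"
  using r_rel_subset s_rel_subset by (simp add: colour_rel_def)

lemma colour_rel_unique:
  assumes "x \<in> carrier G" "y \<in> carrier G" "p \<in> colour_rel x" "p \<in> colour_rel y"
  shows "x = y"
  using assms(1)
proof (cases rule: dih.elem_cases)
  case x: (rotation g)
  show ?thesis using assms(2)
  proof (cases rule: dih.elem_cases)
    case (rotation h)
    with x assms(3,4) show ?thesis using r_rel_unique[of g h p] by simp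
  next
    case (reflection h)
    with x assms(3,4) show ?thesis using r_rel_s_rel_disjoint[of g h p] by simp
  qed
next
  case x: (reflection g)
  show ?thesis using assms(2)
  proof (cases rule: dih.elem_cases)
    case (rotation h)
    with x assms(3,4) show ?thesis using r_rel_s_rel_disjoint[of h g p] by simp
  next
    case (reflection h)
    with x assms(3,4) show ?thesis using s_rel_unique[of g h p] by simp
  qed
qed

lemma colour_rel_nonempty: "x \<in> carrier G \<Longrightarrow> colour_rel x \<noteq> {}"
  using r_rel_nonempty s_rel_nonempty by (elim dih.elem_cases) simp_all

lemma partition_colour_rel: "partition_on (Omega R K \<times> Omega R K) (colour_rel ` carrier G)"
  unfolding partition_on_def
proof (intro conjI)
  show "\<Union> (colour_rel ` carrier G) = Omega R K \<times> Omega R K"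
  proof (intro equalityI subsetI)
    fix p assume "p \<in> Omega R K \<times> Omega R K"
    then obtain \<alpha> \<beta> where p: "p = (\<alpha>, \<beta>)" "\<alpha> \<in> Omega R K" "\<beta> \<in> Omega R K" by blast
    then obtain g where g: "g \<in> carrier C" "p \<in> r_rel R K g \<or> p \<in> s_rel R K g"
      using r_rel_s_rel_cover by blast
    then have "p \<in> colour_rel (\<iota> g) \<or> p \<in> colour_rel (b \<otimes>\<^bsub>G\<^esub> \<iota> g)" by simp
    moreover have "\<iota> g \<in> carrier G" "b \<otimes>\<^bsub>G\<^esub> \<iota> g \<in> carrier G"
      using g(1) dih.\<iota>_closed dih.b_closed by simp_all
    ultimately show "p \<in> \<Union> (colour_rel ` carrier G)" by blast
  qed (use colour_rel_subset in blast)
  show "disjoint (colour_rel ` carrier G)"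
  proof (rule disjointI)
    fix S T assume "S \<in> colour_rel ` carrier G" "T \<in> colour_rel ` carrier G" "S \<noteq> T"
    then show "S \<inter> T = {}" using colour_rel_unique by auto
  qed
  show "{} \<notin> colour_rel ` carrier G" using colour_rel_nonempty by force
qed

lemma inj_colour_rel: "inj_on colour_rel (carrier G)"
proof (rule inj_onI)
  fix x y assume xy: "x \<in> carrier G" "y \<in> carrier G" "colour_rel x = colour_rel y"
  obtain p where "p \<in> colour_rel x" using colour_rel_nonempty[OF xy(1)] by blast
  with xy show "x = y" using colour_rel_unique[of x y p] by simp
qed

lemma colour_rel_converse:
  assumes "x \<in> carrier G"
  shows "(colour_rel x)\<inverse> = colour_rel (inv\<^bsub>G\<^esub> x)"
  using assms
proof (cases rule: dih.elem_cases)
  case (rotation g)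
  then show ?thesis using r_rel_converse by (simp add: dih.inv_rotation)
next
  case (reflection g)
  then show ?thesis using s_rel_sym by (simp add: dih.inv_reflection)
qed

lemma colour_rel_one: "colour_rel \<one>\<^bsub>G\<^esub> = Id_on (Omega R K)"
  using colour_rel_rotation[OF dih.C.one_closed] r_rel_one
    group_hom.hom_one[OF dih.group_hom_\<iota>] by metis

lemma ex_s_rel_iff_colour:
  assumes z: "z \<in> carrier G" and ab: "p \<in> colour_rel z"
  shows "(\<exists>t\<in>carrier C. p \<in> s_rel R K t) \<longleftrightarrow> z \<notin> \<iota> ` carrier C"
  using z
proof (cases rule: dih.elem_cases)
  case (rotation g)
  then have "p \<in> r_rel R K g" using ab by simp
  with rotation show ?thesis using r_rel_s_rel_disjoint[of g _ p] by blast
next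
  case (reflection g)
  then have "p \<in> s_rel R K g" "z \<notin> \<iota> ` carrier C"
    using ab dih.reflection_notin[of g] by simp_all
  with reflection show ?thesis by blast
qed

text \<open>The four products of relations follow the four products of rotations and reflections.
The only deviation from the group law occurs for two reflections: their product is counted with
multiplicity \<open>order R\<close>, and every reflection is added with multiplicity \<open>card K\<close>.\<close>

lemma card_colour_rel:
  assumes x: "x \<in> carrier G" and y: "y \<in> carrier G" and z: "z \<in> carrier G"
    and ab: "(\<alpha>, \<beta>) \<in> colour_rel z"
  shows "card {\<gamma>. (\<alpha>, \<gamma>) \<in> colour_rel x \<and> (\<gamma>, \<beta>) \<in> colour_rel y} =
    (if x \<in> \<iota> ` carrier C \<or> y \<in> \<iota> ` carrier C then 1 else order R) * of_bool (x \<otimes>\<^bsub>G\<^esub> y = z) +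
    (if x \<in> \<iota> ` carrier C \<or> y \<in> \<iota> ` carrier C \<or> z \<in> \<iota> ` carrier C then 0 else card K)"
proof -
  have \<alpha>\<beta>: "\<alpha> \<in> Omega R K" "\<beta> \<in> Omega R K" using ab colour_rel_subset by blast+
  have xyz: "(\<alpha>, \<beta>) \<in> colour_rel (x \<otimes>\<^bsub>G\<^esub> y) \<longleftrightarrow> x \<otimes>\<^bsub>G\<^esub> y = z"
    using colour_rel_unique[OF dih.G.m_closed[OF x y] z] ab by blast
  show ?thesis using x
  proof (cases rule: dih.elem_cases)
    case g: (rotation g)
    show ?thesis using y
    proof (cases rule: dih.elem_cases)
      case h: (rotation h)
      have "x \<otimes>\<^bsub>G\<^esub> y = \<iota> (g \<otimes>\<^bsub>C\<^esub> h)" using g h dih.\<iota>_mult by metis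
      then show ?thesis
        using card_r_r[OF g(1) h(1) \<alpha>\<beta>] xyz g h colour_rel_rotation[OF dih.C.m_closed[OF g(1) h(1)]]
        by simp
    next
      case h: (reflection h)
      have "x \<otimes>\<^bsub>G\<^esub> y = b \<otimes>\<^bsub>G\<^esub> \<iota> (inv\<^bsub>C\<^esub> g \<otimes>\<^bsub>C\<^esub> h)"
        using g h dih.rotation_reflection by metis
      then show ?thesis
        using card_r_s[OF g(1) h(1) \<alpha>\<beta>] xyz g h
          colour_rel_reflection[OF dih.C.m_closed[OF dih.C.inv_closed[OF g(1)] h(1)]]
        by simp
    qed
  next
    case g: (reflection g)
    show ?thesis using y
    proof (cases rule: dih.elem_cases)
      case h: (rotation h)
      have "g \<otimes>\<^bsub>C\<^esub> h = h \<otimes>\<^bsub>C\<^esub> g"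
        using comm_group.abelian_FactGroup[OF comm_group_mult_of K_subgroup] g(1) h(1)
        by (simp add: comm_groupE(4) del: mult_FactGroup)
      then have "x \<otimes>\<^bsub>G\<^esub> y = b \<otimes>\<^bsub>G\<^esub> \<iota> (h \<otimes>\<^bsub>C\<^esub> g)"
        using g h dih.reflection_rotation by metis
      then show ?thesis
        using card_s_r[OF g(1) h(1) \<alpha>\<beta>] xyz g h colour_rel_reflection[OF dih.C.m_closed[OF h(1) g(1)]]
        by simp
    next
      case h: (reflection h)
      have "x \<otimes>\<^bsub>G\<^esub> y = \<iota> (inv\<^bsub>C\<^esub> g \<otimes>\<^bsub>C\<^esub> h)"
        using g h dih.reflection_reflection by metis
      then show ?thesis
        using card_s_s[OF g(1) h(1) \<alpha>\<beta>] xyz g h ex_s_rel_iff_colour[OF z ab]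
          dih.reflection_notin[OF g(1)] dih.reflection_notin[OF h(1)]
          colour_rel_rotation[OF dih.C.m_closed[OF dih.C.inv_closed[OF g(1)] h(1)]]
        by simp
    qed
  qed
qed

lemma finite_G: "finite (carrier G)"
proof -
  have "finite (carrier C)"
  proof -
    have "carrier C \<subseteq> Pow (carrier R)" using coset_nonzero by blast
    then show ?thesis using finite_carrier finite_subset by blast
  qed
  moreover have "carrier G \<subseteq> \<iota> ` carrier C \<union> (\<lambda>g. b \<otimes>\<^bsub>G\<^esub> \<iota> g) ` carrier C"
    by (auto elim!: dih.elem_cases)
  ultimately show ?thesis using finite_subset by blast
qed

text \<open>Since the rotations form a union of basic sets, each basic set consists of rotations only or of
reflections only, so no basic set is lost by the two families in the definition of the scheme.\<close>

lemma scheme_of_eq_image: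
  assumes P: "basic_partition G \<A> P" and C\<A>: "indicator (\<iota> ` carrier C) \<in> \<A>"
  shows "scheme_of R K G \<iota> b \<A> = (\<lambda>X. \<Union>x\<in>X. colour_rel x) ` P"
proof -
  have basic: "basic_sets G \<A> = P" using basic_sets_eq[OF finite_G P] .
  have part: "partition_on (carrier G) P" using P by (simp add: basic_partition_def)
  have rot: "(\<Union>x\<in>\<iota> ` X. colour_rel x) = (\<Union>g\<in>X. r_rel R K g)" if "X \<subseteq> carrier C" for X
    unfolding image_image using that by (intro SUP_cong) auto
  have refl: "(\<Union>x\<in>b <#\<^bsub>G\<^esub> (\<iota> ` Y). colour_rel x) = (\<Union>g\<in>Y. s_rel R K g)"
    if "Y \<subseteq> carrier C" for Y
  proof -
    have "(\<Union>x\<in>b <#\<^bsub>G\<^esub> (\<iota> ` Y). colour_rel x) = (\<Union>g\<in>Y. colour_rel (b \<otimes>\<^bsub>G\<^esub> \<iota> g))"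
      by (auto simp: l_coset_def)
    also have "\<dots> = (\<Union>g\<in>Y. s_rel R K g)" using that by (intro SUP_cong) auto
    finally show ?thesis .
  qed
  have shape: "(\<exists>X'\<subseteq>carrier C. X = \<iota> ` X') \<or> (\<exists>Y\<subseteq>carrier C. X = b <#\<^bsub>G\<^esub> (\<iota> ` Y))"
    if X: "X \<in> P" for X
  proof -
    have sub: "X \<subseteq> carrier G" using X part by (auto simp: partition_on_def)
    have const: "x \<in> \<iota> ` carrier C \<longleftrightarrow> y \<in> \<iota> ` carrier C" if "x \<in> X" "y \<in> X" for x y
      using constant_on_basic_set[OF finite_G P X C\<A> that]
      by (cases "x \<in> \<iota> ` carrier C"; cases "y \<in> \<iota> ` carrier C") simp_all
    show ?thesis
    proof (cases "X \<subseteq> \<iota> ` carrier C")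
      case True
      then show ?thesis unfolding subset_image_iff by blast
    next
      case False
      then have notin: "x \<notin> \<iota> ` carrier C" if "x \<in> X" for x using const that by blast
      have "X \<subseteq> (\<lambda>g. b \<otimes>\<^bsub>G\<^esub> \<iota> g) ` carrier C"
      proof
        fix x assume x: "x \<in> X"
        then have "x \<in> carrier G" using sub by blast
        then show "x \<in> (\<lambda>g. b \<otimes>\<^bsub>G\<^esub> \<iota> g) ` carrier C"
          using notin[OF x] by (cases rule: dih.elem_cases) auto
      qed
      then obtain Y where "Y \<subseteq> carrier C" "X = (\<lambda>g. b \<otimes>\<^bsub>G\<^esub> \<iota> g) ` Y"
        unfolding subset_image_iff by blast
      moreover have "(\<lambda>g. b \<otimes>\<^bsub>G\<^esub> \<iota> g) ` Y = b <#\<^bsub>G\<^esub> (\<iota> ` Y)" for Y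
        by (auto simp: l_coset_def)
      ultimately show ?thesis by metis
    qed
  qed
  show ?thesis
  proof (intro equalityI subsetI)
    fix S assume "S \<in> scheme_of R K G \<iota> b \<A>"
    then consider X where "X \<subseteq> carrier C" "\<iota> ` X \<in> P" "S = (\<Union>g\<in>X. r_rel R K g)"
      | Y where "Y \<subseteq> carrier C" "b <#\<^bsub>G\<^esub> (\<iota> ` Y) \<in> P" "S = (\<Union>g\<in>Y. s_rel R K g)"
      unfolding scheme_of_def basic by blast
    then show "S \<in> (\<lambda>X. \<Union>x\<in>X. colour_rel x) ` P"
    proof cases
      case 1
      show ?thesis unfolding 1(3) rot[OF 1(1), symmetric] using 1(2) by (rule imageI)
    next
      case 2
      show ?thesis unfolding 2(3) refl[OF 2(1), symmetric] using 2(2) by (rule imageI)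
    qed
  next
    fix S assume "S \<in> (\<lambda>X. \<Union>x\<in>X. colour_rel x) ` P"
    then obtain X where X: "X \<in> P" "S = (\<Union>x\<in>X. colour_rel x)" by blast
    from shape[OF X(1)] show "S \<in> scheme_of R K G \<iota> b \<A>"
    proof (elim disjE exE conjE)
      fix X' assume "X' \<subseteq> carrier C" "X = \<iota> ` X'"
      then show ?thesis using X rot[of X'] unfolding scheme_of_def basic by blast
    next
      fix Y assume "Y \<subseteq> carrier C" "X = b <#\<^bsub>G\<^esub> (\<iota> ` Y)"
      then show ?thesis using X refl[of Y] unfolding scheme_of_def basic by blast
    qed
  qed
qed

lemma association_scheme_scheme_of:
  assumes "s_ring G \<A>" and "s_ring_subgroup G \<A> (\<iota> ` carrier C)"
  shows "association_scheme (Omega R K) (scheme_of R K G \<iota> b \<A>)"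
proof -
  obtain P where ring: "subring \<A> (group_ring G)" and P: "basic_partition G \<A> P"
    using assms(1) by (auto simp: s_ring_def)
  have ind: "indicator (\<iota> ` carrier C) \<in> \<A>" using assms(2) by (simp add: s_ring_subgroup_def)
  have "association_scheme (Omega R K) ((\<lambda>X. \<Union>x\<in>X. colour_rel x) ` P)"
  proof (rule dih.G.association_scheme_fusion[OF finite_G finite_Omega ring P _ ind
        partition_colour_rel inj_colour_rel colour_rel_one colour_rel_converse])
    show "\<iota> ` carrier C \<subseteq> carrier G" using dih.\<iota>_closed by blast
    show "card {\<gamma>. (\<alpha>, \<gamma>) \<in> colour_rel x \<and> (\<gamma>, \<beta>) \<in> colour_rel y} =
        (\<lambda>p q. if p \<or> q then 1 else order R) (x \<in> \<iota> ` carrier C) (y \<in> \<iota> ` carrier C)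
          * of_bool (x \<otimes>\<^bsub>G\<^esub> y = z) +
        (\<lambda>p q r. if p \<or> q \<or> r then 0 else card K)
          (x \<in> \<iota> ` carrier C) (y \<in> \<iota> ` carrier C) (z \<in> \<iota> ` carrier C)"
      if "x \<in> carrier G" "y \<in> carrier G" "z \<in> carrier G" "(\<alpha>, \<beta>) \<in> colour_rel z"
      for x y z \<alpha> \<beta>
      using card_colour_rel[OF that] by simp
  qed
  then show ?thesis using scheme_of_eq_image[OF P ind] by simp
qed

end

theorem theorem3p5:
  fixes R :: "('f, 'n) ring_scheme"
    and K :: "'f set"
    and C :: "'f set monoid"
    and G :: "('g, 'm) monoid_scheme"
    and \<iota> :: "'f set \<Rightarrow> 'g"
    and b :: 'g
    and \<A> :: "('g \<Rightarrow> int) set"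
    and r d q n :: nat
  assumes "prime r" and "d \<ge> 1" and "q = r ^ d"
    and "field R" and "finite (carrier R)" and "order R = q"
    and "n \<ge> 1" and "n dvd q - 1" and "even (q * (q - 1) div n)"
    and "subgroup K (mult_of R)" and "card (rcosets\<^bsub>mult_of R\<^esub> K) = n"
    and "C = mult_of R Mod K"
    and "group G" and "\<iota> \<in> mon C G"
    and "b \<in> carrier G" and "group.ord G b = 2"
    and "semidirect_product G (\<iota> ` carrier C) (generate G {b})"
    and "\<And>g. g \<in> carrier C \<Longrightarrow> inv\<^bsub>G\<^esub> b \<otimes>\<^bsub>G\<^esub> \<iota> g \<otimes>\<^bsub>G\<^esub> b = \<iota> (inv\<^bsub>C\<^esub> g)"
    and "s_ring G \<A>"
    and "s_ring_subgroup G \<A> (\<iota> ` carrier C)"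
  shows "association_scheme (Omega R K) (scheme_of R K G \<iota> b \<A>)"
proof -
  interpret R: field R by fact
  interpret G: group G by fact
  interpret M: group "mult_of R" by (rule R.field_mult_group)
  have "card K * n = q - 1"
    using M.lagrange[OF \<open>subgroup K (mult_of R)\<close>] assms(5,6,11) R.order_mult_of
    by (simp add: mult.commute)
  then have "q * (q - 1) div n = q * card K"
    using assms(7) by (metis mult.assoc nonzero_mult_div_cancel_right not_one_le_zero)
  then have "\<ominus>\<^bsub>R\<^esub> \<one>\<^bsub>R\<^esub> \<in> K"
    using R.minus_one_in_subgroup[OF assms(5,10)] assms(6,9) by simp
  then interpret sym: symmetric_plane_classes R K
    using assms(5,10)
    by (intro symmetric_plane_classes.intro plane_classes.intro plane_classes_axioms.intro
        symmetric_plane_classes_axioms.intro R.field_axioms)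
  have b2: "b \<otimes>\<^bsub>G\<^esub> b = \<one>\<^bsub>G\<^esub>"
    using G.pow_ord_eq_1[OF assms(15)] assms(15,16) by (simp add: numeral_2_eq_2)
  have b1: "b \<noteq> \<one>\<^bsub>G\<^esub>" using assms(16) by auto
  have inv_b: "inv\<^bsub>G\<^esub> b = b" using G.inv_equality[OF b2 assms(15,15)] .
  have sdp: "\<iota> ` carrier C \<inter> generate G {b} = {\<one>\<^bsub>G\<^esub>}"
    "(\<iota> ` carrier C) <#>\<^bsub>G\<^esub> generate G {b} = carrier G"
    using assms(17) by (auto simp: semidirect_product_def)
  have b_gen: "b \<in> generate G {b}" by (simp add: generate.incl)
  have gen: "generate G {b} \<subseteq> {\<one>\<^bsub>G\<^esub>, b}"
  proof
    fix x assume "x \<in> generate G {b}"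
    then show "x \<in> {\<one>\<^bsub>G\<^esub>, b}" by (induction rule: generate.induct) (use b2 inv_b assms(15) in auto)
  qed
  have group_C: "group C" using sym.group_C assms(12) by simp
  have "generalized_dihedral G C \<iota> b"
  proof (intro generalized_dihedral.intro generalized_dihedral_axioms.intro)
    show "b \<notin> \<iota> ` carrier C" using b1 b_gen sdp(1) by blast
    show "b \<otimes>\<^bsub>G\<^esub> \<iota> g \<otimes>\<^bsub>G\<^esub> b = \<iota> (inv\<^bsub>C\<^esub> g)" if "g \<in> carrier C" for g
      using assms(18)[OF that] inv_b by simp
    show "x \<in> \<iota> ` carrier C \<or> b \<otimes>\<^bsub>G\<^esub> x \<in> \<iota> ` carrier C" if "x \<in> carrier G" for x
    proof -
      from that have "x \<in> (\<iota> ` carrier C) <#>\<^bsub>G\<^esub> generate G {b}" using sdp(2) by simp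
      then obtain g h where gh: "g \<in> carrier C" "h \<in> generate G {b}" "x = \<iota> g \<otimes>\<^bsub>G\<^esub> h"
        unfolding set_mult_def by blast
      have \<iota>g: "\<iota> g \<in> carrier G" using gh(1) assms(14) by (auto simp: mon_def hom_def)
      consider "h = \<one>\<^bsub>G\<^esub>" | "h = b" using gh(2) gen by blast
      then show ?thesis
      proof cases
        case 1
        then show ?thesis using gh \<iota>g by simp
      next
        case 2
        have "b \<otimes>\<^bsub>G\<^esub> x = \<iota> (inv\<^bsub>C\<^esub> g)"
          using assms(18)[OF gh(1)] inv_b gh(3) 2 \<iota>g assms(15) by (simp add: G.m_assoc)
        then show ?thesis using group.inv_closed[OF group_C gh(1)] by blast
      qed
    qed
  qed (use assms b2 group_C in auto)
  then interpret dihedral_plane R K G \<iota> b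
    using assms(12) sym.symmetric_plane_classes_axioms by (simp add: dihedral_plane_def)
  show ?thesis using association_scheme_scheme_of assms(12,19,20) by simp
qed

end
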